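(* Let $k$ be a positive integer. (1) $C^{ab\,\Omega}_{1/k}(\mathcal I_{k,\delta})=\mathcal H_{k,\Omega}$, with $C^{ab\,\Omega}_{1/k}(\theta^0_m)=\theta_m$. (2) The function $\nu_{1/k}$ satisfies $\nu_{1/k}(z+e_j)=\nu_{1/k}(z)$ and $\nu_{1/k}(z+\Omega\delta e_j)=|\exp(-2\pi ikz_j\delta_j-\pi ik\Omega_{jj}\delta_j^2)|^{-2}\nu_{1/k}(z)$ for $j=1,\dots,l$; i.e. it is the pull-back to $\mathbb C^l$ of a hermitian structure on the line bundle $L_1^k$ over $M$ defined by the factors of automorphy $e(e_j,z)=1$, $e(\Omega\delta e_j,z)=\exp(-2\pi ikz_j\delta_j-\pi ik\Omega_{jj}\delta_j^2)$. (3) Equip $\mathcal H_{k,\Omega}$ with $$\langle\theta,\theta'\rangle=\int_{[0,1]^l\times[0,1]^l}\overline{\theta(\eta+\Omega\delta\xi)}\,\theta'(\eta+\Omega\delta\xi)\,(2k)^{l/2}(\det\Omega_2)^{1/2}(\det\delta)\,e^{-2\pi k(\delta\xi)^T\Omega_2(\delta\xi)}\,d\eta\,d\xi .$$ Then $C^{ab\,\Omega}_{1/k}:(\mathcal I_{k,\delta},(\cdot,\cdot))\to(\mathcal H_{k,\Omega},\langle\cdot,\cdot\rangle)$ is unitary.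
   Context: Let $l\ge1$, $\Omega$ a complex symmetric $l\times l$ matrix with positive definite imaginary part $\Omega_2=\mathrm{Im}\,\Omega$, and $\delta=\mathrm{diag}(\delta_1,\dots,\delta_l)$ with positive integers $\delta_1=1$, $\delta_i\mid\delta_{i+1}$. Let $e_j$ be the standard basis of $\mathbb C^l$, $\Lambda=\mathbb Z^l\oplus\Omega\delta\mathbb Z^l$, $M=\mathbb C^l/\Lambda$ (an abelian variety with polarization of type $\delta$). For $m\in\mathbb Z^l$ (taken modulo $k\delta\mathbb Z^l$), $\theta_m(z)=\sum_{p\in\mathbb Z^l}\exp\big(\pi i(m+k\delta p)\cdot\tfrac{\Omega}{k}(m+k\delta p)+2\pi i(m+k\delta p)\cdot z\big)$, viewed as holomorphic functions on $\mathbb C^l/\mathbb Z^l\cong(\mathbb C^* )^l$; $\mathcal H_{k,\Omega}$ is their span (level $k$ theta functions). On $(S^1)^l=\mathbb R^l/\mathbb Z^l$ let $\theta^0_m(x)=\sum_{p\in\mathbb Z^l}e^{2\pi i(m+k\delta p)\cdot x}$ (distributions), and let $\mathcal I_{k,\delta}$ be their span with the inner product $(\cdot,\cdot)$ making $\{\theta^0_m: m\in\mathbb Z^l/k\delta\mathbb Z^l\}$ orthonormal. For $t>0$, $C^{ab\,\Omega}_t$ maps a distribution $\sum_{\mu\in\mathbb Z^l}b_\mu e^{2\pi i\mu\cdot x}$ (polynomially bounded coefficients) to the holomorphic function $\sum_\mu b_\mu e^{\pi it\,\mu\cdot\Omega\mu}e^{2\pi i\mu\cdot z}$ on $(\mathbb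 C^* )^l$ (the analytic continuation of $e^{\pi t\Delta}$ applied to it, $\Delta=-\frac{i}{4\pi^2}\sum\Omega_{jj'}\partial_{x_j}\partial_{x_{j'}}$). Let $\nu_t(z)=(2/t)^{l/2}(\det\Omega_2)^{-1/2}\exp\big(\frac{\pi}{2t}(z-\bar z)^T\Omega_2^{-1}(z-\bar z)\big)$. *)

theory Defs
  imports "HOL-Analysis.Analysis"
begin

text \<open>Index set of C^l is a finite well-ordered type 'n (l = CARD('n)).
  Vectors in C^l are complex^'n, lattice points int^'n.\<close>

definition cdot :: "'a::comm_ring ^ 'n::finite \<Rightarrow> 'a ^ 'n \<Rightarrow> 'a" where
  "cdot a b = (\<Sum>i\<in>UNIV. a $ i * b $ i)"

definition int2c :: "int ^ 'n::finite \<Rightarrow> complex ^ 'n" where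
  "int2c v = (\<chi> i. of_int (v $ i))"

definition real2c :: "real ^ 'n::finite \<Rightarrow> complex ^ 'n" where
  "real2c v = (\<chi> i. complex_of_real (v $ i))"

definition dmul :: "('n::finite \<Rightarrow> nat) \<Rightarrow> 'a::semiring_1 ^ 'n \<Rightarrow> 'a ^ 'n" where
  "dmul \<delta> v = (\<chi> i. of_nat (\<delta> i) * v $ i)"

definition Im_mat :: "complex ^ 'n ^ 'm \<Rightarrow> real ^ 'n ^ 'm" where
  "Im_mat A = (\<chi> i j. Im (A $ i $ j))"

definition pos_def_real :: "real ^ 'n ^ 'n \<Rightarrow> bool" where
  "pos_def_real A \<longleftrightarrow> (\<forall>v. v \<noteq> 0 \<longrightarrow> v \<bullet> (A *v v) > 0)"

definition cspan :: "('x \<Rightarrow> complex) set \<Rightarrow> ('x \<Rightarrow> complex) set" where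
  "cspan G = {f. \<exists>S c. finite S \<and> S \<subseteq> G \<and> f = (\<lambda>x. \<Sum>g\<in>S. c g * g x)}"

definition theta :: "nat \<Rightarrow> complex ^ 'n ^ 'n \<Rightarrow> ('n::finite \<Rightarrow> nat) \<Rightarrow> int ^ 'n
     \<Rightarrow> complex ^ 'n \<Rightarrow> complex" where
  "theta k \<Omega> \<delta> m z = (\<Sum>\<^sub>\<infinity>p\<in>UNIV.
      (let \<mu> = int2c (m + of_nat k *s dmul \<delta> p) in
        exp (pi * \<i> * cdot \<mu> ((1 / of_nat k) *s (\<Omega> *v \<mu>)) + 2 * pi * \<i> * cdot \<mu> z)))"

definition H_space :: "nat \<Rightarrow> complex ^ 'n ^ 'n \<Rightarrow> ('n::finite \<Rightarrow> nat)
     \<Rightarrow> (complex ^ 'n \<Rightarrow> complex) set" where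
  "H_space k \<Omega> \<delta> = cspan (range (theta k \<Omega> \<delta>))"

text \<open>A distribution sum_mu b_mu e^{2 pi i mu.x} on (S^1)^l is represented by its Fourier
  coefficient function b :: int^'n => complex. theta0 m has coefficient 1 at mu iff
  mu \<in> m + k delta Z^l, and 0 otherwise.\<close>
definition theta0 :: "nat \<Rightarrow> ('n::finite \<Rightarrow> nat) \<Rightarrow> int ^ 'n \<Rightarrow> int ^ 'n \<Rightarrow> complex" where
  "theta0 k \<delta> m = (\<lambda>\<mu>. if \<exists>p. \<mu> = m + of_nat k *s dmul \<delta> p then 1 else 0)"

definition I_space :: "nat \<Rightarrow> ('n::finite \<Rightarrow> nat) \<Rightarrow> (int ^ 'n \<Rightarrow> complex) set" where
  "I_space k \<delta> = cspan (range (theta0 k \<delta>))"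

definition reps :: "nat \<Rightarrow> ('n::finite \<Rightarrow> nat) \<Rightarrow> (int ^ 'n) set" where
  "reps k \<delta> = {m. \<forall>i. 0 \<le> m $ i \<and> m $ i < int (k * \<delta> i)}"

text \<open>Inner product on I_{k,delta} making {theta0 m : m \<in> Z^l/k delta Z^l} orthonormal:
  for f = sum_m a_m theta0_m (m over representatives), a_m = f m; conjugate-linear in
  the first argument.\<close>
definition I_inner :: "nat \<Rightarrow> ('n::finite \<Rightarrow> nat) \<Rightarrow> (int ^ 'n \<Rightarrow> complex)
     \<Rightarrow> (int ^ 'n \<Rightarrow> complex) \<Rightarrow> complex" where
  "I_inner k \<delta> f g = (\<Sum>m\<in>reps k \<delta>. cnj (f m) * g m)"

text \<open>The (analytically continued) heat operator C^{ab Omega}_t.\<close>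
definition C_ab :: "complex ^ 'n ^ 'n \<Rightarrow> real \<Rightarrow> (int ^ 'n::finite \<Rightarrow> complex)
     \<Rightarrow> complex ^ 'n \<Rightarrow> complex" where
  "C_ab \<Omega> t b z = (\<Sum>\<^sub>\<infinity>\<mu>\<in>UNIV. b \<mu> * exp (pi * \<i> * of_real t * cdot (int2c \<mu>) (\<Omega> *v int2c \<mu>))
                                  * exp (2 * pi * \<i> * cdot (int2c \<mu>) z))"

definition nu :: "complex ^ 'n ^ 'n \<Rightarrow> real \<Rightarrow> complex ^ 'n::finite \<Rightarrow> complex" where
  "nu \<Omega> t z = (let w = z - (\<chi> i. cnj (z $ i)); \<Omega>2 = Im_mat \<Omega> in
     complex_of_real ((2 / t) powr (real CARD('n) / 2) * (det \<Omega>2) powr (-1/2))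
     * exp (complex_of_real (pi / (2 * t)) * cdot w (map_matrix complex_of_real (matrix_inv \<Omega>2) *v w)))"

definition H_inner :: "nat \<Rightarrow> complex ^ 'n ^ 'n \<Rightarrow> ('n::finite \<Rightarrow> nat)
     \<Rightarrow> (complex ^ 'n \<Rightarrow> complex) \<Rightarrow> (complex ^ 'n \<Rightarrow> complex) \<Rightarrow> complex" where
  "H_inner k \<Omega> \<delta> f g =
     (LINT q : cbox (0::real^'n) One \<times> cbox (0::real^'n) One | lborel.
        (let \<eta> = fst q; \<xi> = snd q; z = real2c \<eta> + \<Omega> *v real2c (dmul \<delta> \<xi>) in
          cnj (f z) * g z
          * complex_of_real ((2 * real k) powr (real CARD('n) / 2) * (det (Im_mat \<Omega>)) powr (1/2)
               * real (\<Prod>i\<in>UNIV. \<delta> i)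
               * exp (- 2 * pi * real k * (dmul \<delta> \<xi> \<bullet> (Im_mat \<Omega> *v dmul \<delta> \<xi>))))))"

end

theory Submission
  imports Defs "HOL-Probability.Distributions"
begin

text \<open>
  The map only sees Fourier coefficients, and elements of the source space are bounded coefficient
  functions on the lattice that are periodic modulo k delta. Expanding both factors of the inner
  product as absolutely convergent Fourier series and integrating over the real torus kills all
  off-diagonal terms. For a diagonal term, completing the square turns the weight into a Gaussian
  centred at the lattice point, so the sum over one residue class unfolds the integral over the unit
  cube into a Gaussian integral over the whole space, which the constant in front normalises to one.
  Injectivity follows from the isometry, and surjectivity from termwise evaluation on generators.
\<close>

subsection \<open>Positive definite forms and Gaussian integrals\<close>

text \<open>The time 1/k makes the square close up: the squared modulus of the heat term of mu at
  eta + Omega delta xi, times the weight, is a Gaussian in mu + k delta xi, with the very step k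
  delta by which a residue class moves. Passing from mu to mu + k delta p is therefore the
  translation of xi by p. The resulting form in xi has matrix 2k delta Omega_2 delta, and the square
  root of its determinant is (2k)^(l/2) (det Omega_2)^(1/2) det delta, the constant of the inner
  product. The obstacle is analytic: two infinite series stand under the integral. A single use of
  Fubini, for counting measure on pairs of lattice points against Lebesgue measure on the compact
  double cube, settles it, since the Gaussian bound on heat terms is uniform there. Summability of
  that bound again comes from unfolding, now read as a bound of a sum by an integral. Unfolding is
  done for nonnegative integrals, so that convergence is an outcome and not a premise.\<close>

lemma inner_sym_matrix:
  fixes A :: "real ^ 'n ^ 'n"
  assumes "transpose A = A"
  shows "u \<bullet> (A *v v) = v \<bullet> (A *v u)"
  by (metis assms dot_lmul_matrix inner_commute transpose_matrix_vector)

text \<open>Gram-Schmidt for the form \<open>b\<close>, phrased through a maximal orthonormal set.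
  The substitution by \<open>P\<close> later turns a general Gaussian into the standard one.\<close>

lemma pos_def_real_congruent_one:
  fixes A :: "real ^ 'n ^ 'n"
  assumes sym: "transpose A = A" and pos: "pos_def_real A"
  obtains P :: "real ^ 'n ^ 'n" where "transpose P ** A ** P = mat 1"
proof -
  define b where "b u v = u \<bullet> (A *v v)" for u v
  have b_commute: "b u v = b v u" for u v
    unfolding b_def by (rule inner_sym_matrix[OF sym])
  have b_pos: "b v v > 0" if "v \<noteq> 0" for v
    using pos that by (simp add: b_def pos_def_real_def)
  have b_diff: "b u (v - w) = b u v - b u w" for u v w
    by (simp add: b_def matrix_vector_mult_diff_distrib inner_diff_right)
  have b_scale: "b u (c *\<^sub>R v) = c * b u v" for u v c
    by (simp add: b_def matrix_vector_mult_scaleR)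
  have b_sum: "b u (\<Sum>i\<in>I. g i) = (\<Sum>i\<in>I. b u (g i))" if "finite I" for u I and g :: "real ^ 'n \<Rightarrow> real ^ 'n"
    using that by (induction rule: finite_induct) (simp_all add: b_def matrix_vector_right_distrib inner_add_right)
  define ortho where "ortho S \<longleftrightarrow> finite S \<and> (\<forall>u\<in>S. \<forall>v\<in>S. b u v = (if u = v then 1 else 0))" for S
  have b_comb: "b u (\<Sum>v\<in>S. c v *\<^sub>R v) = c u" if "ortho S" "u \<in> S" for S u c
  proof -
    have "b u (\<Sum>v\<in>S. c v *\<^sub>R v) = (\<Sum>v\<in>S. c v * b u v)"
      using that by (subst b_sum) (auto simp: ortho_def b_scale)
    also have "\<dots> = (\<Sum>v\<in>S. if u = v then c v else 0)"
      by (rule sum.cong) (use that in \<open>auto simp: ortho_def\<close>)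
    also have "\<dots> = c u" using that by (simp add: ortho_def)
    finally show ?thesis .
  qed
  have indep: "independent S" if "ortho S" for S
  proof
    assume "dependent S"
    moreover have "finite S" using that by (simp add: ortho_def)
    ultimately obtain c u where "u \<in> S" "c u \<noteq> 0" "(\<Sum>v\<in>S. c v *\<^sub>R v) = 0"
      by (auto simp: real_vector.dependent_finite)
    with b_comb[OF that, of u c] show False by (simp add: b_def)
  qed
  \<comment> \<open>Orthonormal sets are independent, so their size is capped by the dimension and
    one of maximal size exists.\<close>
  have "ortho {}" by (simp add: ortho_def)
  moreover have "\<forall>S. ortho S \<longrightarrow> card S < CARD('n) + 1"
    using indep independent_bound by fastforce
  ultimately obtain S where S: "ortho S" and max: "\<And>T. ortho T \<Longrightarrow> card T \<le> card S"
    using ex_has_greatest_nat[of ortho "{}" card "CARD('n) + 1"] by auto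
  have finS: "finite S" using S by (simp add: ortho_def)
  have "span S = UNIV"
  proof (rule ccontr)
    assume "span S \<noteq> UNIV"
    then obtain v where v: "v \<notin> span S" by auto
    \<comment> \<open>The part of \<open>v\<close> that is \<open>b\<close>-orthogonal to
      \<open>S\<close>; normalised, it would enlarge the maximal set.\<close>
    define w where "w = v - (\<Sum>u\<in>S. b u v *\<^sub>R u)"
    have sp: "(\<Sum>u\<in>S. b u v *\<^sub>R u) \<in> span S"
      by (intro span_sum span_scale span_base)
    have w: "w \<notin> span S"
      using v span_add[OF _ sp, of w] by (auto simp: w_def)
    then have w0: "w \<noteq> 0" using span_0 by auto
    define w' where "w' = (1 / sqrt (b w w)) *\<^sub>R w"
    have w': "w' \<notin> span S"
      using w b_pos[OF w0] span_scale[of w' S "sqrt (b w w)"] by (auto simp: w'_def)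
    have "b u w = 0" if "u \<in> S" for u
      using b_comb[OF S that] by (simp add: w_def b_diff)
    then have uw': "b u w' = 0" if "u \<in> S" for u
      using that by (simp add: w'_def b_scale)
    have "b w w / sqrt (b w w) / sqrt (b w w) = 1"
    proof -
      have "sqrt (b w w) * sqrt (b w w) = b w w" "b w w \<noteq> 0"
        using b_pos[OF w0] less_imp_le by auto
      then show ?thesis by (metis divide_divide_eq_left divide_self)
    qed
    moreover have "b w' w' = 1 / sqrt (b w w) * b w' w"
      by (subst (2) w'_def) (rule b_scale)
    moreover have "b w w' = 1 / sqrt (b w w) * b w w"
      unfolding w'_def by (rule b_scale)
    ultimately have "b w' w' = 1" using b_commute[of w w'] by simp
    have wu': "b w' u = 0" if "u \<in> S" for u
      using uw'[OF that] by (simp only: b_commute[of w' u])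
    have "w' \<notin> S"
      using w' span_base by blast
    have ortho: "ortho (insert w' S)"
      using S uw' wu' \<open>b w' w' = 1\<close> by (auto simp: ortho_def)
    have "card (insert w' S) = card S + 1"
      using \<open>w' \<notin> S\<close> finS by simp
    then show False using max[OF ortho] by simp
  qed
  then have "card S = CARD('n)"
    using dim_eq_card_independent[OF indep[OF S]] dim_span[of S] by simp
  then obtain f :: "'n \<Rightarrow> real ^ 'n" where f: "bij_betw f UNIV S"
    using finite_same_card_bij[OF finite finS] by auto
  \<comment> \<open>The basis vectors form the columns, so the entries of the congruent matrix are
    the values of \<open>b\<close> on basis pairs.\<close>
  define P :: "real ^ 'n ^ 'n" where "P = (\<chi> i j. f j $ i)"
  have "(transpose P ** A ** P) $ i $ j = b (f i) (f j)" for i j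
  proof -
    have "(transpose P ** A ** P) $ i $ j = (transpose P ** (A ** P)) $ i $ j"
      by (simp add: matrix_mul_assoc)
    then show ?thesis
      by (simp add: matrix_matrix_mult_def matrix_vector_mult_def P_def transpose_def b_def inner_vec_def)
  qed
  moreover have "b (f i) (f j) = (if i = j then 1 else 0)" for i j
  proof -
    have "f i \<in> S" "f j \<in> S" "f i = f j \<longleftrightarrow> i = j"
      using f by (auto simp: bij_betw_def inj_def)
    then show ?thesis using S by (simp add: ortho_def)
  qed
  ultimately have "transpose P ** A ** P = mat 1"
    by (simp add: vec_eq_iff mat_def)
  then show ?thesis using that by blast
qed

text \<open>The minimum over the compact unit sphere is positive, and homogeneity of degree two
  carries it to all vectors.\<close>

lemma pos_def_real_lower_bound:
  fixes A :: "real ^ 'n ^ 'n"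
  assumes "pos_def_real A"
  obtains c where "c > 0" "\<And>v. v \<bullet> (A *v v) \<ge> c * (norm v)\<^sup>2"
proof -
  have "compact (sphere (0::real^'n) 1)" "sphere (0::real^'n) 1 \<noteq> {}" by auto
  moreover have "continuous_on (sphere 0 1) (\<lambda>v. v \<bullet> (A *v v))"
    by (intro continuous_intros matrix_vector_mult_linear_continuous_on)
  ultimately obtain u where u: "u \<in> sphere 0 1" "\<And>v. v \<in> sphere 0 1 \<Longrightarrow> u \<bullet> (A *v u) \<le> v \<bullet> (A *v v)"
    using continuous_attains_inf[of "sphere 0 1" "\<lambda>v. v \<bullet> (A *v v)"] by blast
  show ?thesis
  proof
    show "u \<bullet> (A *v u) > 0"
    proof -
      have "u \<noteq> 0" using u(1) by auto
      then show ?thesis using assms by (simp add: pos_def_real_def)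
    qed
    show "v \<bullet> (A *v v) \<ge> (u \<bullet> (A *v u)) * (norm v)\<^sup>2" for v
    proof (cases "v = 0")
      case False
      then have "u \<bullet> (A *v u) \<le> (v /\<^sub>R norm v) \<bullet> (A *v (v /\<^sub>R norm v))"
        by (intro u(2)) simp
      also have "\<dots> = (v \<bullet> (A *v v)) / (norm v)\<^sup>2"
        by (simp add: matrix_vector_mult_scaleR power2_eq_square divide_inverse)
      finally show ?thesis using False by (simp add: field_simps)
    qed simp
  qed
qed

text \<open>Lebesgue measure is characterised by the volumes of boxes, so it suffices to compare the
  rescaled image measure with it on boxes. Working with nonnegative integrals avoids any
  integrability premise.\<close>

lemma nn_integral_lborel_matrix:
  fixes P :: "real ^ 'n::{finite,wellorder} ^ 'n::{finite,wellorder}"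
  assumes [measurable]: "f \<in> borel_measurable borel" and d: "det P \<noteq> 0"
  shows "(\<integral>\<^sup>+x. f x \<partial>lborel) = \<bar>det P\<bar> * (\<integral>\<^sup>+x. f (P *v x) \<partial>lborel)"
proof -
  obtain Q where Q: "P ** Q = mat 1" "Q ** P = mat 1"
    using d invertible_det_nz[of P] by (auto simp: invertible_def)
  have dPQ: "\<bar>det P\<bar> * \<bar>det Q\<bar> = 1"
    using Q(1) det_mul[of P Q] by (simp add: det_I flip: abs_mult)
  have cont: "continuous_on UNIV ((*v) P)" for P :: "real^'n::_^'n::_"
    by (rule matrix_vector_mult_linear_continuous_on)
  have [measurable]: "((*v) P) \<in> borel_measurable borel"
    using cont by (rule borel_measurable_continuous_onI)
  have "lborel = density (distr lborel borel ((*v) P)) (\<lambda>_. \<bar>det P\<bar>)" (is "_ = ?D")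
  proof (rule lborel_eqI)
    fix l u :: "real^'n::_" assume le: "\<And>b. b \<in> Basis \<Longrightarrow> l \<bullet> b \<le> u \<bullet> b"
    \<comment> \<open>Trading the preimage under \<open>P\<close> for the image under its inverse
      makes the volume formula for linear images applicable.\<close>
    have "(\<lambda>x. P *v x) -` box l u = (\<lambda>x. Q *v x) ` box l u"
      using Q by (force simp: matrix_vector_mul_assoc)
    moreover have "emeasure lborel ((\<lambda>x. Q *v x) ` box l u) = ennreal (\<bar>det Q\<bar> * measure lborel (box l u))"
    proof -
      have "(\<lambda>x. Q *v x) ` box l u \<in> lmeasurable"
        by (intro measurable_linear_image) auto
      then have "emeasure lebesgue ((\<lambda>x. Q *v x) ` box l u) = ennreal (\<bar>det Q\<bar> * measure lebesgue (box l u))"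
        using measure_linear_image[of "(*v) Q" "box l u"] by (subst emeasure_eq_measure2) auto
      moreover have "(\<lambda>x. Q *v x) ` box l u \<in> sets borel"
      proof -
        have "(\<lambda>x. P *v x) -` box l u \<in> sets borel"
          using measurable_sets[of "(*v) P" borel borel "box l u"] by simp
        then show ?thesis using \<open>(\<lambda>x. P *v x) -` box l u = _\<close> by simp
      qed
      ultimately show ?thesis by (simp add: emeasure_completion measure_completion)
    qed
    ultimately show "emeasure ?D (box l u) = (\<Prod>b\<in>Basis. (u - l) \<bullet> b)"
      using le dPQ by (simp add: emeasure_density nn_integral_cmult emeasure_distr nn_integral_cmult_indicator
        flip: ennreal_mult' mult.assoc)
  qed simp
  then have "(\<integral>\<^sup>+x. f x \<partial>lborel) = (\<integral>\<^sup>+x. f x \<partial>?D)" by simp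
  also have "\<dots> = \<bar>det P\<bar> * (\<integral>\<^sup>+x. f (P *v x) \<partial>lborel)"
    by (simp add: nn_integral_density nn_integral_distr nn_integral_cmult)
  finally show ?thesis .
qed

lemma nn_integral_lborel_shift:
  fixes a :: "'a::euclidean_space"
  assumes [measurable]: "f \<in> borel_measurable borel"
  shows "(\<integral>\<^sup>+x. f (x + a) \<partial>lborel) = (\<integral>\<^sup>+x. f x \<partial>lborel)"
proof -
  have "(\<integral>\<^sup>+x. f x \<partial>lborel) = (\<integral>\<^sup>+x. f x \<partial>distr lborel borel ((+) a))"
    by (simp add: lborel_distr_plus)
  also have "\<dots> = (\<integral>\<^sup>+x. f (x + a) \<partial>lborel)"
    by (simp add: nn_integral_distr add.commute)
  finally show ?thesis ..
qed

text \<open>With standard deviation 1 / sqrt(2 pi) the normal density has prefactor 1, so the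
  integral is a product of total masses of probability densities.\<close>

lemma nn_integral_gauss_std:
  "(\<integral>\<^sup>+(x::'a::euclidean_space). ennreal (exp (- pi * (x \<bullet> x))) \<partial>lborel) = 1"
proof -
  have "normal_density 0 (1 / sqrt (2 * pi)) x = exp (- pi * x\<^sup>2)" for x
    by (simp add: normal_density_def power_divide)
  then have "(\<integral>\<^sup>+x. ennreal (exp (- pi * x\<^sup>2)) \<partial>lborel) = 1"
    using nn_integral_eq_integral[OF integrable_normal_density[of "1 / sqrt (2*pi)" 0]]
      integral_normal_density[of "1 / sqrt (2*pi)" 0] by simp
  then have "(\<integral>\<^sup>+(x::'a). (\<Prod>b\<in>Basis. ennreal (exp (- pi * (x \<bullet> b)\<^sup>2))) \<partial>lborel) = 1"
    by (subst nn_integral_lborel_prod) auto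
  moreover have "exp (- pi * (x \<bullet> x)) = (\<Prod>b\<in>Basis. exp (- pi * (x \<bullet> b)\<^sup>2))" for x :: 'a
    by (subst euclidean_inner) (simp add: sum_distrib_left power2_eq_square flip: exp_sum)
  ultimately show ?thesis by (simp add: prod_ennreal)
qed

text \<open>Both claims come from one congruence: taking determinants gives (det P)^2 det A = 1,
  which forces the sign and identifies the Jacobian |det P| with the value of the integral.\<close>

lemma
  fixes A :: "real ^ 'n::{finite,wellorder} ^ 'n::{finite,wellorder}"
  assumes sym: "transpose A = A" and pos: "pos_def_real A"
  shows pos_def_real_det_pos: "det A > 0"
    and nn_integral_gauss: "(\<integral>\<^sup>+x. ennreal (exp (- pi * (x \<bullet> (A *v x)))) \<partial>lborel) = ennreal (1 / sqrt (det A))"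
proof -
  obtain P :: "real^'n::_^'n::_" where P: "transpose P ** A ** P = mat 1"
    using pos_def_real_congruent_one[OF sym pos] by blast
  have "det P * det A * det P = 1"
    using arg_cong[OF P, of det] by (simp add: det_mul)
  then have d: "(det P)\<^sup>2 * det A = 1" by (simp add: power2_eq_square mult_ac)
  then have dP: "det P \<noteq> 0" by auto
  have "det A = 1 / (det P)\<^sup>2" using d dP by (simp add: field_simps)
  then show "det A > 0" using dP by simp
  have "(P *v x) \<bullet> (A *v (P *v x)) = x \<bullet> x" for x
  proof -
    have "(P *v x) \<bullet> (A *v (P *v x)) = x \<bullet> (transpose P *v (A *v (P *v x)))"
      by (metis dot_lmul_matrix transpose_matrix_vector inner_commute)
    then show ?thesis using P by (simp add: matrix_vector_mul_assoc matrix_mul_assoc)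
  qed
  moreover have "1 / sqrt (det A) = \<bar>det P\<bar>"
    using \<open>det A = _\<close> by (simp add: real_sqrt_divide)
  moreover have "continuous_on UNIV (\<lambda>x. x \<bullet> (A *v x))"
    by (intro continuous_intros matrix_vector_mult_linear_continuous_on)
  then have [measurable]: "(\<lambda>x. x \<bullet> (A *v x)) \<in> borel_measurable borel"
    by (rule borel_measurable_continuous_onI)
  ultimately show "(\<integral>\<^sup>+x. ennreal (exp (- pi * (x \<bullet> (A *v x)))) \<partial>lborel) = ennreal (1 / sqrt (det A))"
    using nn_integral_gauss_std[where 'a="real^'n::_"] by (subst nn_integral_lborel_matrix[OF _ dP]) auto
qed

subsection \<open>Lattice sums\<close>

definition int2r :: "int ^ 'n \<Rightarrow> real ^ 'n" where
  "int2r p = (\<chi> i. real_of_int (p $ i))"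

lemma int2r_component [simp]: "int2r p $ i = real_of_int (p $ i)"
  by (simp add: int2r_def)

lemma One_component [simp]: "(One :: real^'n) $ i = 1"
proof -
  have "(One :: real^'n) \<bullet> axis i 1 = (\<Sum>b\<in>Basis. if b = (axis i 1 :: real^'n) then 1 else 0)"
    unfolding inner_sum_left by (intro sum.cong) (auto simp: inner_Basis axis_in_Basis_iff)
  then show ?thesis by (simp add: cart_eq_inner_axis axis_in_Basis_iff)
qed

lemma mem_unit_cbox: "x \<in> cbox (0::real^'n) One \<longleftrightarrow> (\<forall>i. 0 \<le> x $ i \<and> x $ i \<le> 1)"
  by (simp add: mem_box_cart del: sum_component)

text \<open>The integer translates of the half-open cube tile the space, and Tonelli exchanges the
  sum over tiles with the integral. The closed cube appears in the result because
  \<open>H_inner\<close> integrates over it.\<close>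

lemma nn_integral_unfold_lattice:
  fixes f :: "real ^ 'n \<Rightarrow> ennreal"
  assumes [measurable]: "f \<in> borel_measurable borel"
  shows "(\<integral>\<^sup>+x. f x \<partial>lborel) =
    (\<integral>\<^sup>+p. (\<integral>\<^sup>+x. f (x + int2r p) * indicator (cbox 0 One) x \<partial>lborel) \<partial>count_space UNIV)"
proof -
  \<comment> \<open>Half-open, so that every point lies in exactly one translate; the closed cube
    differs only by a null set of faces.\<close>
  define U :: "(real^'n) set" where "U = {x. \<forall>i. 0 \<le> x $ i \<and> x $ i < 1}"
  have [measurable]: "U \<in> sets borel"
  proof -
    have "U = (\<Inter>i. {x. 0 \<le> x $ i} \<inter> {x. x $ i < 1})" by (auto simp: U_def)
    moreover have "closed {x :: real^'n. 0 \<le> x $ i}" "open {x :: real^'n. x $ i < 1}" for i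
      by (auto intro!: closed_Collect_le open_Collect_less continuous_intros)
    ultimately show ?thesis by (auto intro!: sets.countable_INT'' borel_open borel_closed)
  qed
  \<comment> \<open>The unique translate containing \<open>x\<close> is given by the vector of
    floors, so the indicators sum to 1 over \<open>p\<close>.\<close>
  have floor: "indicator U (x - int2r p) = (indicator {\<chi> i. \<lfloor>x $ i\<rfloor>} p :: ennreal)" for x p
  proof -
    have "x - int2r p \<in> U \<longleftrightarrow> (\<forall>i. p $ i = \<lfloor>x $ i\<rfloor>)"
      by (auto simp: U_def floor_eq_iff eq_commute[of "p $ _"] algebra_simps)
    then show ?thesis by (auto simp: indicator_def vec_eq_iff)
  qed
  have "cbox 0 One - box 0 One \<in> null_sets (lborel :: (real^'n) measure)"
    using negligible_frontier_interval[of 0 "One :: real^'n"]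
    by (simp add: negligible_iff_null_sets null_sets_completion_iff)
  then have "AE x::real^'n in lborel. x \<notin> cbox 0 One - box 0 One"
    by (rule AE_not_in)
  then have AE_U: "AE x::real^'n in lborel. indicator U x = (indicator (cbox 0 One) x :: ennreal)"
  proof eventually_elim
    case (elim x)
    have "x \<in> box 0 One \<Longrightarrow> x \<in> U"
      by (auto simp: U_def mem_box_cart less_imp_le simp del: sum_component)
    moreover have "x \<in> U \<Longrightarrow> x \<in> cbox 0 One"
      by (auto simp: U_def mem_unit_cbox less_imp_le)
    ultimately show ?case using elim by (auto simp: indicator_def)
  qed
  have "(\<integral>\<^sup>+x. f x \<partial>lborel) = (\<integral>\<^sup>+x. \<integral>\<^sup>+p. f x * indicator U (x - int2r p) \<partial>count_space UNIV \<partial>lborel)"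
    by (intro nn_integral_cong) (simp add: floor nn_integral_cmult_indicator)
  also have "\<dots> = (\<integral>\<^sup>+p. \<integral>\<^sup>+x. f x * indicator U (x - int2r p) \<partial>lborel \<partial>count_space UNIV)"
    by (intro nn_integral_count_space_nn_integral) auto
  also have "\<dots> = (\<integral>\<^sup>+p. \<integral>\<^sup>+x. f (x + int2r p) * indicator U x \<partial>lborel \<partial>count_space UNIV)"
  proof (rule nn_integral_cong)
    fix p :: "int^'n"
    have "(\<integral>\<^sup>+x. f (x + int2r p) * indicator U (x + int2r p - int2r p) \<partial>lborel) =
        (\<integral>\<^sup>+x. f x * indicator U (x - int2r p) \<partial>lborel)"
      by (rule nn_integral_lborel_shift[of "\<lambda>x. f x * indicator U (x - int2r p)"]) simp
    then show "(\<integral>\<^sup>+x. f x * indicator U (x - int2r p) \<partial>lborel) = (\<integral>\<^sup>+x. f (x + int2r p) * indicator U x \<partial>lborel)"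
      by simp
  qed
  also have "\<dots> = (\<integral>\<^sup>+p. \<integral>\<^sup>+x. f (x + int2r p) * indicator (cbox 0 One) x \<partial>lborel \<partial>count_space UNIV)"
  proof (rule nn_integral_cong)
    fix p :: "int^'n"
    have "AE x in lborel. f (x + int2r p) * indicator U x = f (x + int2r p) * indicator (cbox 0 One) x"
      using AE_U by eventually_elim simp
    then show "(\<integral>\<^sup>+x. f (x + int2r p) * indicator U x \<partial>lborel) =
        (\<integral>\<^sup>+x. f (x + int2r p) * indicator (cbox 0 One) x \<partial>lborel)"
      by (rule nn_integral_cong_AE)
  qed
  finally show ?thesis .
qed

text \<open>Together with the next lemma, this turns series into integrals over counting measure, so
  that Fubini can exchange a series with an integral.\<close>

lemma integrable_count_space_iff_summable_on:
  fixes f :: "'a \<Rightarrow> 'b::{banach, second_countable_topology}"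
  shows "integrable (count_space A) f \<longleftrightarrow> (\<lambda>x. norm (f x)) summable_on A"
  by (simp add: abs_summable_equivalent abs_summable_on_def)

lemma integral_count_space_eq_infsum:
  fixes f :: "'a \<Rightarrow> 'b::{banach, second_countable_topology}"
  assumes "integrable (count_space A) f"
  shows "(LINT x|count_space A. f x) = infsum f A"
  using infsetsum_infsum[of f A] assms by (simp add: abs_summable_on_def infsetsum_def)

text \<open>Each term is dominated, up to a constant, by the integral of a wider Gaussian over the
  unit cell at \<open>p\<close>; by unfolding, these integrals add up to a finite Gaussian
  integral.\<close>

lemma lattice_gauss_summable:
  assumes "a > 0"
  shows "(\<lambda>p :: int^'n::{finite,wellorder}. exp (- a * (norm (int2r p))\<^sup>2)) summable_on UNIV"
proof -
  \<comment> \<open>Scaled so that pi times its quadratic form is (a/2) |x|^2, the wider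
    Gaussian.\<close>
  define A :: "real^'n::_^'n::_" where "A = mat (a / (2 * pi))"
  have Av: "A *v x = (a / (2 * pi)) *\<^sub>R x" for x
    by (simp add: A_def vec_eq_iff matrix_vector_mult_def mat_def if_distrib if_distribR cong: if_cong)
  have "transpose A = A" by (simp add: A_def)
  moreover have "pos_def_real A" using assms by (auto simp: pos_def_real_def Av)
  ultimately have "(\<integral>\<^sup>+x. ennreal (exp (- pi * (x \<bullet> (A *v x)))) \<partial>lborel) < \<infinity>"
    by (subst nn_integral_gauss) auto
  then have fin: "(\<integral>\<^sup>+(x::real^'n::_). ennreal (exp (- (a / 2) * (norm x)\<^sup>2)) \<partial>lborel) < \<infinity>"
    by (simp add: Av power2_norm_eq_inner)
  \<comment> \<open>The loss within a cell: |x + p|^2 is at most 2 |x|^2 + 2 |p|^2 by the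
    parallelogram law, and |x|^2 is at most the dimension on the unit cube.\<close>
  define c where "c = exp (- a * CARD('n))"
  have bound: "c * exp (- a * (norm (int2r p))\<^sup>2) \<le> exp (- (a / 2) * (norm (x + int2r p))\<^sup>2)"
    if "x \<in> cbox 0 One" for x :: "real^'n::_" and p
  proof -
    have "(norm x)\<^sup>2 = (\<Sum>i\<in>UNIV. (x $ i)\<^sup>2)"
      unfolding power2_norm_eq_inner by (simp add: inner_vec_def power2_eq_square)
    also have "\<dots> \<le> (\<Sum>i\<in>(UNIV::'n set). 1)"
      using that by (intro sum_mono) (simp add: mem_unit_cbox power_le_one)
    finally have x: "(norm x)\<^sup>2 \<le> CARD('n)" by simp
    have "(norm (x + int2r p))\<^sup>2 + (norm (x - int2r p))\<^sup>2 = 2 * (norm x)\<^sup>2 + 2 * (norm (int2r p))\<^sup>2"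
      by (simp add: power2_norm_eq_inner inner_add_left inner_add_right inner_diff_left inner_diff_right)
    then have "(norm (x + int2r p))\<^sup>2 \<le> 2 * CARD('n) + 2 * (norm (int2r p))\<^sup>2"
      using x zero_le_power2[of "norm (x - int2r p)"] by linarith
    then have "a * (norm (x + int2r p))\<^sup>2 \<le> a * (2 * CARD('n) + 2 * (norm (int2r p))\<^sup>2)"
      using assms by (intro mult_left_mono) auto
    then show ?thesis by (simp add: c_def algebra_simps flip: exp_add)
  qed
  have "c * (\<integral>\<^sup>+p. ennreal (exp (- a * (norm (int2r p))\<^sup>2)) \<partial>count_space (UNIV :: (int^'n::_) set)) =
    (\<integral>\<^sup>+p. \<integral>\<^sup>+x. ennreal (c * exp (- a * (norm (int2r p))\<^sup>2)) * indicator (cbox 0 One) (x::real^'n::_) \<partial>lborel \<partial>count_space (UNIV :: (int^'n::_) set))"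
    by (subst nn_integral_cmult[symmetric]) (auto simp: c_def ennreal_mult' nn_integral_cmult_indicator intro!: nn_integral_cong)
  also have "\<dots> \<le> (\<integral>\<^sup>+p. \<integral>\<^sup>+x. ennreal (exp (- (a / 2) * (norm (x + int2r p))\<^sup>2)) * indicator (cbox 0 One) (x::real^'n::_) \<partial>lborel \<partial>count_space (UNIV :: (int^'n::_) set))"
    by (intro nn_integral_mono) (use bound in \<open>auto simp: indicator_def intro!: ennreal_leI\<close>)
  also have "\<dots> = (\<integral>\<^sup>+(x::real^'n::_). ennreal (exp (- (a / 2) * (norm x)\<^sup>2)) \<partial>lborel)"
    by (subst nn_integral_unfold_lattice) auto
  finally have "c * (\<integral>\<^sup>+p. ennreal (exp (- a * (norm (int2r p))\<^sup>2)) \<partial>count_space (UNIV :: (int^'n::_) set)) < \<infinity>"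
    using fin by (rule le_less_trans)
  then have "(\<integral>\<^sup>+p. ennreal (exp (- a * (norm (int2r p))\<^sup>2)) \<partial>count_space (UNIV :: (int^'n::_) set)) < \<infinity>"
    by (auto simp: ennreal_mult_less_top c_def)
  then show ?thesis
    using integrable_count_space_iff_summable_on[of UNIV "\<lambda>p::int^'n::_. exp (- a * (norm (int2r p))\<^sup>2)"]
    by (simp add: integrable_iff_bounded)
qed

subsection \<open>The heat operator on Fourier coefficients\<close>

definition Im_vec :: "complex ^ 'n \<Rightarrow> real ^ 'n" where
  "Im_vec z = (\<chi> i. Im (z $ i))"

lemma Im_vec_add: "Im_vec (z + w) = Im_vec z + Im_vec w"
  by (simp add: Im_vec_def vec_eq_iff)

lemma Im_vec_real2c [simp]: "Im_vec (real2c x) = 0"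
  by (simp add: Im_vec_def real2c_def vec_eq_iff)

lemma Im_vec_mult_real2c: "Im_vec (\<Omega> *v real2c x) = Im_mat \<Omega> *v x"
  by (simp add: Im_vec_def real2c_def Im_mat_def vec_eq_iff matrix_vector_mult_def)

lemma int2c_eq_real2c: "int2c \<mu> = real2c (int2r \<mu>)"
  by (simp add: int2c_def real2c_def vec_eq_iff)

lemma Im_cdot_int2c: "Im (cdot (int2c \<mu>) z) = int2r \<mu> \<bullet> Im_vec z"
  by (simp add: cdot_def int2c_def inner_vec_def Im_vec_def)

lemma transpose_Im_mat: "transpose \<Omega> = \<Omega> \<Longrightarrow> transpose (Im_mat \<Omega>) = Im_mat \<Omega>"
  by (simp add: transpose_def Im_mat_def vec_eq_iff)

definition heat_term :: "complex ^ 'n ^ 'n \<Rightarrow> real \<Rightarrow> int ^ 'n \<Rightarrow> complex ^ 'n \<Rightarrow> complex" where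
  "heat_term \<Omega> t \<mu> z = exp (pi * \<i> * of_real t * cdot (int2c \<mu>) (\<Omega> *v int2c \<mu>))
     * exp (2 * pi * \<i> * cdot (int2c \<mu>) z)"

lemma C_ab_heat_term: "C_ab \<Omega> t b z = (\<Sum>\<^sub>\<infinity>\<mu>. b \<mu> * heat_term \<Omega> t \<mu> z)"
  by (simp add: C_ab_def heat_term_def mult.assoc)

lemma norm_heat_term:
  "norm (heat_term \<Omega> t \<mu> z) =
     exp (- pi * t * (int2r \<mu> \<bullet> (Im_mat \<Omega> *v int2r \<mu>)) - 2 * pi * (int2r \<mu> \<bullet> Im_vec z))"
proof -
  have "Re (pi * \<i> * of_real t * cdot (int2c \<mu>) (\<Omega> *v int2c \<mu>)) =
      - pi * t * (int2r \<mu> \<bullet> (Im_mat \<Omega> *v int2r \<mu>))"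
    using Im_cdot_int2c[of \<mu> "\<Omega> *v int2c \<mu>"] by (simp add: int2c_eq_real2c Im_vec_mult_real2c)
  moreover have "Re (2 * pi * \<i> * cdot (int2c \<mu>) z) = - 2 * pi * (int2r \<mu> \<bullet> Im_vec z)"
    by (simp add: Im_cdot_int2c)
  ultimately show ?thesis
    by (simp add: heat_term_def norm_mult norm_exp_eq_Re flip: exp_add)
qed

text \<open>Completing the square absorbs the linear term into half of the quadratic decay.\<close>
lemma heat_term_bound:
  fixes \<Omega> :: "complex ^ 'n ^ 'n"
  assumes "pos_def_real (Im_mat \<Omega>)" and t: "t > 0" and R: "R \<ge> 0"
  obtains a C where "a > 0" "C > 0"
    "\<And>\<mu> z. norm (Im_vec z) \<le> R \<Longrightarrow> norm (heat_term \<Omega> t \<mu> z) \<le> C * exp (- a * (norm (int2r \<mu>))\<^sup>2)"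
proof -
  obtain c where c: "c > 0" "\<And>v. v \<bullet> (Im_mat \<Omega> *v v) \<ge> c * (norm v)\<^sup>2"
    using pos_def_real_lower_bound[OF assms(1)] by blast
  \<comment> \<open>\<open>a\<close> is half of the decay rate pi t c. \<open>r\<close> makes the
    linear term bounded by 2 pi R s the cross term of a (s - r)^2, and \<open>K\<close> is the
    constant left over. All three depend on \<open>z\<close> only through the bound
    \<open>R\<close>.\<close>
  define a where "a = pi * t * c / 2"
  define r where "r = pi * R / a"
  define K where "K = a * r\<^sup>2"
  have a: "a > 0" using c t by (simp add: a_def)
  then have r: "pi * R = a * r" by (simp add: r_def)
  show ?thesis
  proof
    fix \<mu> :: "int ^ 'n" and z :: "complex ^ 'n"
    assume z: "norm (Im_vec z) \<le> R"
    let ?s = "norm (int2r \<mu>)"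
    have "pi * t * (c * ?s\<^sup>2) \<le> pi * t * (int2r \<mu> \<bullet> (Im_mat \<Omega> *v int2r \<mu>))"
      using c(2) t by (intro mult_left_mono) auto
    then have 1: "2 * a * ?s\<^sup>2 \<le> pi * t * (int2r \<mu> \<bullet> (Im_mat \<Omega> *v int2r \<mu>))"
      by (simp add: a_def mult_ac)
    have "\<bar>int2r \<mu> \<bullet> Im_vec z\<bar> \<le> ?s * R"
      using Cauchy_Schwarz_ineq2 z by (meson mult_left_mono norm_ge_zero order_trans)
    then have "2 * pi * (- (int2r \<mu> \<bullet> Im_vec z)) \<le> 2 * pi * (?s * R)"
      by (intro mult_left_mono) auto
    also have "2 * pi * (?s * R) = 2 * (pi * R) * ?s" by simp
    finally have 2: "- 2 * pi * (int2r \<mu> \<bullet> Im_vec z) \<le> 2 * (a * r) * ?s"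
      unfolding r by simp
    have "0 \<le> a * (?s - r)\<^sup>2" using a by simp
    also have "\<dots> = a * ?s\<^sup>2 - 2 * (a * r) * ?s + K"
      by (simp add: K_def power2_diff algebra_simps)
    finally have "2 * (a * r) * ?s \<le> a * ?s\<^sup>2 + K" by simp
    with 1 2 show "norm (heat_term \<Omega> t \<mu> z) \<le> exp K * exp (- a * ?s\<^sup>2)"
      by (simp add: norm_heat_term flip: exp_add)
  qed (use a in auto)
qed

lemma heat_series_abs_summable:
  fixes \<Omega> :: "complex ^ 'n::{finite,wellorder} ^ 'n::{finite,wellorder}"
  assumes "pos_def_real (Im_mat \<Omega>)" "t > 0" "\<And>\<mu>. norm (b \<mu>) \<le> B"
  shows "(\<lambda>\<mu>. norm (b \<mu> * heat_term \<Omega> t \<mu> z)) summable_on UNIV"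
proof -
  obtain a C where aC: "a > 0" "C > 0"
    "\<And>\<mu> w. norm (Im_vec w) \<le> norm (Im_vec z) \<Longrightarrow> norm (heat_term \<Omega> t \<mu> w) \<le> C * exp (- a * (norm (int2r \<mu>))\<^sup>2)"
    using heat_term_bound[OF assms(1,2) norm_ge_zero] by metis
  have "(\<lambda>\<mu>. B * (C * exp (- a * (norm (int2r \<mu> :: real^'n::_))\<^sup>2))) summable_on UNIV"
    by (intro summable_on_cmult_right lattice_gauss_summable aC)
  then show ?thesis
  proof (rule summable_on_comparison_test)
    fix \<mu>
    show "norm (b \<mu> * heat_term \<Omega> t \<mu> z) \<le> B * (C * exp (- a * (norm (int2r \<mu>))\<^sup>2))"
      unfolding norm_mult by (intro mult_mono assms aC order_refl) (use norm_ge_zero assms(3) order_trans in blast)+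
  qed auto
qed

section \<open>Residue classes modulo k delta and the two spans\<close>

lemma cspan_finite_image:
  assumes "finite R"
  shows "cspan (h ` R) = range (\<lambda>a x. \<Sum>i\<in>R. a i * h i x)"
proof (intro equalityI subsetI)
  fix f assume "f \<in> cspan (h ` R)"
  then obtain S c where S: "finite S" "S \<subseteq> h ` R" "f = (\<lambda>x. \<Sum>g\<in>S. c g * g x)"
    by (auto simp: cspan_def)
  obtain R' where R': "R' \<subseteq> R" "inj_on h R'" "S = h ` R'"
    using S(2) by (auto simp: subset_image_inj)
  have f: "f = (\<lambda>x. \<Sum>i\<in>R. (if i \<in> R' then c (h i) else 0) * h i x)"
  proof
    fix x
    have "f x = (\<Sum>i\<in>R'. c (h i) * h i x)"
      by (simp add: S(3) R'(3) sum.reindex[OF R'(2)])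
    also have "\<dots> = (\<Sum>i\<in>R. (if i \<in> R' then c (h i) else 0) * h i x)"
      by (rule sum.mono_neutral_cong_left) (use assms R' in auto)
    finally show "f x = \<dots>" .
  qed
  show "f \<in> range (\<lambda>a x. \<Sum>i\<in>R. a i * h i x)"
    by (rule image_eqI[where x = "\<lambda>i. if i \<in> R' then c (h i) else 0"], rule f, rule UNIV_I)
next
  fix f assume "f \<in> range (\<lambda>a x. \<Sum>i\<in>R. a i * h i x)"
  then obtain a where f: "f = (\<lambda>x. \<Sum>i\<in>R. a i * h i x)" by auto
  \<comment> \<open>In the other direction, the coefficients of all indices naming the same function
    are added up.\<close>
  define c where "c g = (\<Sum>i\<in>{i\<in>R. h i = g}. a i)" for g
  have "f = (\<lambda>x. \<Sum>g\<in>h ` R. c g * g x)"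
  proof
    fix x
    have "f x = (\<Sum>g\<in>h ` R. \<Sum>i\<in>{i\<in>R. h i = g}. a i * h i x)"
      unfolding f by (rule sum.image_gen[OF assms])
    also have "\<dots> = (\<Sum>g\<in>h ` R. c g * g x)"
      by (intro sum.cong refl) (simp add: c_def sum_distrib_right)
    finally show "f x = \<dots>" .
  qed
  then show "f \<in> cspan (h ` R)"
    using assms unfolding cspan_def by blast
qed

text \<open>Comparing remainders coordinatewise makes symmetry and transitivity immediate;
  \<open>same_class_iff\<close> recovers the coset form that \<open>theta0\<close> uses.\<close>

definition same_class :: "nat \<Rightarrow> ('n \<Rightarrow> nat) \<Rightarrow> int ^ 'n \<Rightarrow> int ^ 'n \<Rightarrow> bool" where
  "same_class k \<delta> \<mu> \<nu> \<longleftrightarrow> (\<forall>i. \<mu> $ i mod int (k * \<delta> i) = \<nu> $ i mod int (k * \<delta> i))"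

definition reduce :: "nat \<Rightarrow> ('n \<Rightarrow> nat) \<Rightarrow> int ^ 'n \<Rightarrow> int ^ 'n" where
  "reduce k \<delta> \<mu> = (\<chi> i. \<mu> $ i mod int (k * \<delta> i))"

lemma same_class_reduce: "same_class k \<delta> \<mu> (reduce k \<delta> \<mu>)"
  by (simp add: same_class_def reduce_def)

lemma reduce_in_reps: "k > 0 \<Longrightarrow> \<forall>i. \<delta> i > 0 \<Longrightarrow> reduce k \<delta> \<mu> \<in> reps k \<delta>"
  by (simp add: reps_def reduce_def flip: of_nat_mult)

lemma same_class_iff: "same_class k \<delta> \<mu> m \<longleftrightarrow> (\<exists>p. \<mu> = m + of_nat k *s dmul \<delta> p)"
proof
  assume "same_class k \<delta> \<mu> m"
  then have "\<forall>i. \<exists>q. \<mu> $ i - m $ i = int (k * \<delta> i) * q"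
    unfolding same_class_def mod_eq_dvd_iff by (auto elim!: dvdE)
  then obtain q where "\<And>i. \<mu> $ i - m $ i = int (k * \<delta> i) * q i" by metis
  then have "\<mu> = m + of_nat k *s dmul \<delta> (\<chi> i. q i)"
    by (simp add: vec_eq_iff dmul_def algebra_simps)
  then show "\<exists>p. \<mu> = m + of_nat k *s dmul \<delta> p" ..
next
  assume "\<exists>p. \<mu> = m + of_nat k *s dmul \<delta> p"
  then show "same_class k \<delta> \<mu> m"
    by (auto simp: same_class_def dmul_def mod_eq_dvd_iff)
qed

lemma theta0_same_class: "theta0 k \<delta> m \<mu> = (if same_class k \<delta> \<mu> m then 1 else 0)"
  by (simp add: theta0_def same_class_iff)

lemma theta0_reduce: "theta0 k \<delta> (reduce k \<delta> m) = theta0 k \<delta> m"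
  by (simp add: fun_eq_iff theta0_same_class same_class_def reduce_def)

lemma finite_reps: "finite (reps k \<delta>)"
proof (rule finite_subset)
  show "reps k \<delta> \<subseteq> (\<lambda>f. \<chi> i. f i) ` (\<Pi>\<^sub>E i\<in>UNIV. {0..<int (k * \<delta> i)})"
  proof
    fix m assume "m \<in> reps k \<delta>"
    then have "(\<lambda>i. m $ i) \<in> (\<Pi>\<^sub>E i\<in>UNIV. {0..<int (k * \<delta> i)})"
      by (auto simp: reps_def)
    then show "m \<in> (\<lambda>f. \<chi> i. f i) ` (\<Pi>\<^sub>E i\<in>UNIV. {0..<int (k * \<delta> i)})"
      by (intro image_eqI[of _ _ "\<lambda>i. m $ i"]) (simp_all add: vec_eq_iff)
  qed
qed (auto intro!: finite_PiE)

lemma range_theta0: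
  assumes "k > 0" "\<forall>i. \<delta> i > 0"
  shows "range (theta0 k \<delta>) = theta0 k \<delta> ` reps k \<delta>"
proof -
  have "theta0 k \<delta> m \<in> theta0 k \<delta> ` reps k \<delta>" for m
    using theta0_reduce[of k \<delta> m] reduce_in_reps[OF assms, of m] by (metis image_eqI)
  then show ?thesis by blast
qed

lemma I_space_eq:
  assumes "k > 0" "\<forall>i. \<delta> i > 0"
  shows "I_space k \<delta> = range (\<lambda>a \<mu>. \<Sum>m\<in>reps k \<delta>. a m * theta0 k \<delta> m \<mu>)"
  by (simp add: I_space_def range_theta0[OF assms] cspan_finite_image finite_reps)

lemma I_space_periodic:
  assumes "k > 0" "\<forall>i. \<delta> i > 0" "f \<in> I_space k \<delta>" "same_class k \<delta> \<mu> \<nu>"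
  shows "f \<mu> = f \<nu>"
  using assms by (auto simp: I_space_eq theta0_same_class same_class_def)

text \<open>A periodic function takes only the finitely many values it has on representatives.
  Boundedness is what makes its heat series converge.\<close>

lemma I_space_bounded:
  assumes "k > 0" "\<forall>i. \<delta> i > 0" "f \<in> I_space k \<delta>"
  obtains B where "\<And>\<mu>. norm (f \<mu>) \<le> B"
proof -
  have "norm (f \<mu>) \<le> (\<Sum>m\<in>reps k \<delta>. norm (f m))" for \<mu>
  proof -
    have "norm (f (reduce k \<delta> \<mu>)) \<le> (\<Sum>m\<in>reps k \<delta>. norm (f m))"
      by (rule member_le_sum) (use finite_reps reduce_in_reps assms in auto)
    then show ?thesis
      using I_space_periodic[OF assms same_class_reduce] by metis
  qed
  then show ?thesis using that by blast
qed

text \<open>The coefficients of \<open>theta0\<close> cut the sum down to one coset, and positivity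
  of k delta makes its parametrisation by \<open>p\<close> injective.\<close>

lemma C_ab_theta0:
  assumes "k > 0" "\<forall>i. \<delta> i > 0"
  shows "C_ab \<Omega> (1 / real k) (theta0 k \<delta> m) = theta k \<Omega> \<delta> m"
proof
  fix z
  define h where "h p = m + of_nat k *s dmul \<delta> p" for p
  have inj: "inj h"
    using assms by (auto simp: h_def inj_def dmul_def vec_eq_iff simp flip: neq0_conv)
  have "C_ab \<Omega> (1 / real k) (theta0 k \<delta> m) z = (\<Sum>\<^sub>\<infinity>\<mu>\<in>range h. heat_term \<Omega> (1 / real k) \<mu> z)"
    unfolding C_ab_heat_term
    by (rule infsum_cong_neutral) (auto simp: theta0_def h_def)
  also have "\<dots> = (\<Sum>\<^sub>\<infinity>p. heat_term \<Omega> (1 / real k) (h p) z)"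
    by (subst infsum_reindex[OF inj]) (simp add: o_def)
  also have "\<dots> = theta k \<Omega> \<delta> m z"
    by (simp add: theta_def heat_term_def h_def Let_def cdot_def sum_distrib_left mult_ac exp_add divide_inverse)
  finally show "C_ab \<Omega> (1 / real k) (theta0 k \<delta> m) z = theta k \<Omega> \<delta> m z" .
qed

text \<open>An infinite sum is additive only over summable pieces, which the bound on
  \<open>h\<close> guarantees; \<open>theta0\<close> takes only the values 0 and 1.\<close>

lemma C_ab_sum:
  fixes \<Omega> :: "complex ^ 'n::{finite,wellorder} ^ 'n::{finite,wellorder}"
  assumes "pos_def_real (Im_mat \<Omega>)" "t > 0" "finite R" "\<And>m \<mu>. m \<in> R \<Longrightarrow> norm (h m \<mu>) \<le> 1"
  shows "C_ab \<Omega> t (\<lambda>\<mu>. \<Sum>m\<in>R. a m * h m \<mu>) z = (\<Sum>m\<in>R. a m * C_ab \<Omega> t (h m) z)"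
proof -
  have hs: "((\<lambda>\<mu>. a m * (h m \<mu> * heat_term \<Omega> t \<mu> z)) has_sum a m * C_ab \<Omega> t (h m) z) UNIV" if "m \<in> R" for m
    unfolding C_ab_heat_term
    using abs_summable_summable[OF heat_series_abs_summable[OF assms(1,2) assms(4)[OF that]]]
    by (intro has_sum_cmult_right has_sum_infsum)
  have "((\<lambda>\<mu>. \<Sum>m\<in>R. a m * (h m \<mu> * heat_term \<Omega> t \<mu> z)) has_sum (\<Sum>m\<in>R. a m * C_ab \<Omega> t (h m) z)) UNIV"
    using \<open>finite R\<close> hs by (induction R rule: finite_induct) (auto intro: has_sum_add)
  then show ?thesis
    unfolding C_ab_heat_term[of _ _ "\<lambda>\<mu>. \<Sum>m\<in>R. a m * h m \<mu>"] by (simp add: infsumI sum_distrib_right mult.assoc)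
qed

lemma C_ab_image_I_space:
  fixes \<Omega> :: "complex ^ 'n::{finite,wellorder} ^ 'n::{finite,wellorder}"
  assumes "pos_def_real (Im_mat \<Omega>)" "k > 0" "\<forall>i. \<delta> i > 0"
  shows "C_ab \<Omega> (1 / real k) ` I_space k \<delta> = H_space k \<Omega> \<delta>"
proof -
  have "range (theta k \<Omega> \<delta>) = C_ab \<Omega> (1 / real k) ` range (theta0 k \<delta>)"
    by (simp add: image_image C_ab_theta0[OF assms(2,3)])
  also have "\<dots> = (\<lambda>m. C_ab \<Omega> (1 / real k) (theta0 k \<delta> m)) ` reps k \<delta>"
    by (simp add: range_theta0[OF assms(2,3)] image_image)
  finally have "H_space k \<Omega> \<delta> = range (\<lambda>a z. \<Sum>m\<in>reps k \<delta>. a m * C_ab \<Omega> (1 / real k) (theta0 k \<delta> m) z)"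
    by (simp add: H_space_def cspan_finite_image finite_reps)
  also have "\<dots> = range (\<lambda>a. C_ab \<Omega> (1 / real k) (\<lambda>\<mu>. \<Sum>m\<in>reps k \<delta>. a m * theta0 k \<delta> m \<mu>))"
  proof (intro arg_cong[where f = range] ext)
    show "(\<Sum>m\<in>reps k \<delta>. a m * C_ab \<Omega> (1 / real k) (theta0 k \<delta> m) z) =
        C_ab \<Omega> (1 / real k) (\<lambda>\<mu>. \<Sum>m\<in>reps k \<delta>. a m * theta0 k \<delta> m \<mu>) z" for a z
      using assms by (intro C_ab_sum[symmetric] finite_reps) (auto simp: theta0_def)
  qed
  finally show ?thesis
    by (simp add: I_space_eq[OF assms(2,3)] image_image)
qed

section \<open>The function nu under the period lattice\<close>

lemma nu_eq:
  "nu \<Omega> t z = complex_of_real ((2 / t) powr (real CARD('n) / 2) * det (Im_mat \<Omega>) powr (-1/2)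
     * exp (- (2 * pi / t) * (Im_vec z \<bullet> (matrix_inv (Im_mat \<Omega>) *v Im_vec z))))"
  for z :: "complex ^ 'n"
proof -
  define w where "w = z - (\<chi> i. cnj (z $ i))"
  define B where "B = matrix_inv (Im_mat \<Omega>)"
  \<comment> \<open>Since w = 2i Im z, its square brings a factor -4, which turns pi / (2t) into -2
    pi / t.\<close>
  have "w $ i = 2 * \<i> * complex_of_real (Im_vec z $ i)" for i
    by (simp add: w_def Im_vec_def complex_eq_iff)
  then have "cdot w (map_matrix complex_of_real B *v w) = complex_of_real (- 4 * (Im_vec z \<bullet> (B *v Im_vec z)))"
    by (simp add: cdot_def matrix_vector_mult_def map_matrix_def inner_vec_def sum_distrib_left mult_ac flip: sum_negf)
  then show ?thesis
    unfolding nu_def Let_def w_def[symmetric] B_def[symmetric] by (simp add: mult.assoc flip: exp_of_real)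
qed

lemma nu_add_axis: "nu \<Omega> t (z + axis j 1) = nu \<Omega> t z"
proof -
  have "Im_vec (z + axis j 1) = Im_vec z"
    by (simp add: Im_vec_def vec_eq_iff axis_def)
  then show ?thesis by (simp add: nu_eq)
qed

text \<open>The period moves Im z by \<open>A *v u\<close>. As \<open>B\<close> is the inverse of
  \<open>A\<close>, it drops out of the cross terms, leaving 2 (u . y) + u . A u, which depends only
  on the entries at \<open>j\<close>.\<close>

lemma nu_add_period:
  fixes \<Omega> :: "complex ^ 'n ^ 'n"
  assumes sym: "transpose \<Omega> = \<Omega>" and det: "det (Im_mat \<Omega>) \<noteq> 0"
  shows "nu \<Omega> (1 / real k) (z + \<Omega> *v dmul \<delta> (axis j 1)) =
             complex_of_real (norm (exp (- 2 * pi * \<i> * of_nat k * z $ j * of_nat (\<delta> j)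
                   - pi * \<i> * of_nat k * \<Omega> $ j $ j * of_nat (\<delta> j) ^ 2)) powr (-2))
             * nu \<Omega> (1 / real k) z"
proof -
  define A where "A = Im_mat \<Omega>"
  define B where "B = matrix_inv A"
  define u :: "real ^ 'n" where "u = axis j (real (\<delta> j))"
  define y where "y = Im_vec z"
  have "invertible A" using det by (simp add: A_def invertible_det_nz)
  \<comment> \<open>\<open>matrix_inv\<close> is a choice operator; invertibility provides the
    witness that fixes its value.\<close>
  then have "A ** B = mat 1 \<and> B ** A = mat 1"
    unfolding B_def invertible_def matrix_inv_def by (rule someI_ex)
  then have inv: "A ** B = mat 1" "B ** A = mat 1" by auto
  have "dmul \<delta> (axis j 1) = real2c u"
    by (simp add: dmul_def real2c_def u_def axis_def vec_eq_iff)
  then have Im: "Im_vec (z + \<Omega> *v dmul \<delta> (axis j 1)) = y + A *v u"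
    by (simp add: Im_vec_add Im_vec_mult_real2c A_def y_def)
  have symA: "transpose A = A" using sym by (simp add: A_def transpose_Im_mat)
  have "(A *v u) \<bullet> (B *v y) = u \<bullet> y"
    using inner_sym_matrix[OF symA, of "B *v y" u]
    by (simp add: inner_commute matrix_vector_mul_assoc inv)
  then have "(y + A *v u) \<bullet> (B *v (y + A *v u)) = y \<bullet> (B *v y) + 2 * (u \<bullet> y) + u \<bullet> (A *v u)"
    by (simp add: matrix_vector_right_distrib inner_add_left inner_add_right matrix_vector_mul_assoc inv inner_commute)
  moreover have "u \<bullet> y = real (\<delta> j) * Im (z $ j)"
    by (simp add: u_def y_def Im_vec_def inner_axis')
  moreover have "(A *v u) $ j = real (\<delta> j) * Im (\<Omega> $ j $ j)"
    by (simp add: matrix_vector_mult_def u_def A_def Im_mat_def axis_def if_distrib cong: if_cong)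
  then have "u \<bullet> (A *v u) = (real (\<delta> j))\<^sup>2 * Im (\<Omega> $ j $ j)"
    by (simp add: u_def inner_axis' power2_eq_square)
  moreover have "norm (exp (- 2 * pi * \<i> * of_nat k * z $ j * of_nat (\<delta> j)
                   - pi * \<i> * of_nat k * \<Omega> $ j $ j * of_nat (\<delta> j) ^ 2)) powr (-2)
      = exp (- 2 * (2 * pi * k * Im (z $ j) * \<delta> j + pi * k * Im (\<Omega> $ j $ j) * (\<delta> j)\<^sup>2))"
    by (simp add: norm_exp_eq_Re powr_def power2_eq_square)
  ultimately have "exp (- (2 * pi / (1 / real k)) * ((y + A *v u) \<bullet> (B *v (y + A *v u)))) =
      norm (exp (- 2 * pi * \<i> * of_nat k * z $ j * of_nat (\<delta> j)
                   - pi * \<i> * of_nat k * \<Omega> $ j $ j * of_nat (\<delta> j) ^ 2)) powr (-2)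
      * exp (- (2 * pi / (1 / real k)) * (y \<bullet> (B *v y)))"
    by (simp add: algebra_simps flip: exp_add)
  then show ?thesis
    unfolding nu_eq Im A_def[symmetric] B_def[symmetric] y_def[symmetric]
    by (simp only: of_real_mult mult_ac)
qed

subsection \<open>Integrals over the torus\<close>

lemma integral_lborel_prod:
  fixes \<phi> :: "'a::euclidean_space \<Rightarrow> real \<Rightarrow> complex"
  assumes int: "\<And>b. b \<in> Basis \<Longrightarrow> integrable lborel (\<phi> b)"
  shows "(LINT x|lborel. (\<Prod>b\<in>Basis. \<phi> b (x \<bullet> b))) = (\<Prod>b\<in>Basis. LINT s|lborel. \<phi> b s)"
proof -
  interpret product_sigma_finite "\<lambda>_::'a. lborel :: real measure" ..
  have [measurable]: "\<phi> b \<in> borel_measurable borel" if "b \<in> Basis" for b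
    using borel_measurable_integrable[OF int[OF that]] by simp
  have [measurable]: "(\<lambda>x. \<Prod>b\<in>Basis. \<phi> b (x \<bullet> b)) \<in> borel_measurable borel"
  proof (rule borel_measurable_prod)
    fix b :: 'a assume [simp]: "b \<in> Basis"
    have "(\<lambda>x. x \<bullet> b) \<in> borel_measurable borel" by simp
    moreover have "\<phi> b \<in> borel_measurable borel" by measurable
    ultimately show "(\<lambda>x. \<phi> b (x \<bullet> b)) \<in> borel_measurable borel"
      by (rule measurable_compose)
  qed
  have "(LINT x|lborel. (\<Prod>b\<in>Basis. \<phi> b (x \<bullet> b))) =
      (LINT f|(\<Pi>\<^sub>M b\<in>Basis. lborel). (\<Prod>b\<in>Basis. \<phi> b ((\<Sum>b\<in>Basis. f b *\<^sub>R b) \<bullet> b)))"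
    by (subst lborel_eq[where 'a='a]) (subst integral_distr, auto)
  also have "\<dots> = (LINT f|(\<Pi>\<^sub>M b\<in>Basis. lborel). (\<Prod>b\<in>Basis. \<phi> b (f b)))"
    by (intro Bochner_Integration.integral_cong prod.cong refl) simp
  also have "\<dots> = (\<Prod>b\<in>Basis. LINT s|lborel. \<phi> b s)"
    by (rule product_integral_prod) (use int in auto)
  finally show ?thesis .
qed

text \<open>For nonzero n the primitive takes equal values at both ends, because exp(2 pi i n) =
  1.\<close>

lemma integral_exp_unit_interval:
  "(LINT s|lborel. indicator {0..1} s *\<^sub>R exp (2 * pi * \<i> * of_int n * complex_of_real s)) = (if n = 0 then 1 else 0)"
proof (cases "n = 0")
  case False
  let ?c = "2 * pi * \<i> * of_int n :: complex"
  have c: "?c \<noteq> 0" using False by simp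
  have "(LINT s|lborel. indicator {0..1} s *\<^sub>R exp (?c * complex_of_real s)) =
      exp (?c * complex_of_real 1) / ?c - exp (?c * complex_of_real 0) / ?c"
  proof (rule integral_FTC_atLeastAtMost)
    fix s :: real
    have "((\<lambda>w. exp (?c * w) / ?c) has_field_derivative exp (?c * complex_of_real s)) (at (complex_of_real s))"
      using c by (auto intro!: derivative_eq_intros)
    then show "((\<lambda>s. exp (?c * complex_of_real s) / ?c) has_vector_derivative exp (?c * complex_of_real s)) (at s within {0..1})"
      by (rule has_vector_derivative_real_field)
  qed (auto intro!: continuous_intros)
  moreover have "exp (?c) = 1"
    using exp_integer_2pi[of "of_int n"] by (simp add: mult_ac)
  ultimately show ?thesis using False by simp
qed simp

lemma integral_exp_unit_cube:
  fixes \<nu> :: "int ^ 'n"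
  shows "(LINT x|lborel. indicator (cbox 0 One) x *\<^sub>R exp (2 * pi * \<i> * complex_of_real (int2r \<nu> \<bullet> x))) =
    (if \<nu> = 0 then 1 else 0)"
proof -
  define \<phi> where "\<phi> b s = indicator {0..1} s *\<^sub>R exp (2 * pi * \<i> * complex_of_real (int2r \<nu> \<bullet> b) * complex_of_real s)"
    for b :: "real ^ 'n" and s :: real
  \<comment> \<open>The character and the cutoff both split over coordinates; outside the cube some
    one-dimensional cutoff already vanishes.\<close>
  have 1: "indicator (cbox 0 One) x *\<^sub>R exp (2 * pi * \<i> * complex_of_real (int2r \<nu> \<bullet> x)) = (\<Prod>b\<in>Basis. \<phi> b (x \<bullet> b))"
    for x :: "real ^ 'n"
  proof (cases "x \<in> cbox 0 One")
    case True
    then have "\<phi> b (x \<bullet> b) = exp (2 * pi * \<i> * complex_of_real ((int2r \<nu> \<bullet> b) * (x \<bullet> b)))" if "b \<in> Basis" for b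
      using that by (auto simp: \<phi>_def mem_box mult_ac)
    then show ?thesis
      using True by (subst euclidean_inner) (simp add: sum_distrib_left flip: exp_sum)
  next
    case False
    then obtain b where "b \<in> Basis" "x \<bullet> b \<notin> {0..1}" by (auto simp: mem_box)
    then have "\<phi> b (x \<bullet> b) = 0" by (simp add: \<phi>_def)
    with False \<open>b \<in> Basis\<close> show ?thesis by (auto simp: prod_zero_iff)
  qed
  have "integrable lborel (\<phi> b)" for b
    unfolding \<phi>_def by (intro borel_integrable_compact continuous_intros) auto
  then have "(LINT x|lborel. indicator (cbox 0 One) x *\<^sub>R exp (2 * pi * \<i> * complex_of_real (int2r \<nu> \<bullet> x))) =
      (\<Prod>b\<in>Basis. LINT s|lborel. \<phi> b s)"
    unfolding 1 by (intro integral_lborel_prod)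
  also have "\<dots> = (\<Prod>b\<in>Basis. if int2r \<nu> \<bullet> b = 0 then 1 else 0)"
  proof (rule prod.cong)
    fix b :: "real ^ 'n" assume "b \<in> Basis"
    then obtain i where b: "b = axis i 1" by (auto simp: Basis_vec_def)
    show "(LINT s|lborel. \<phi> b s) = (if int2r \<nu> \<bullet> b = 0 then 1 else 0)"
      using integral_exp_unit_interval[of "\<nu> $ i"] by (simp add: \<phi>_def b inner_axis)
  qed simp
  also have "\<dots> = (if \<nu> = 0 then 1 else 0)"
  proof -
    have "\<nu> = 0 \<longleftrightarrow> (\<forall>b\<in>Basis. int2r \<nu> \<bullet> b = 0)"
      by (auto simp: Basis_vec_def inner_axis vec_eq_iff)
    then show ?thesis by (auto simp: prod_zero_iff)
  qed
  finally show ?thesis .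
qed

section \<open>The Gaussian integral that fixes the normalising constant\<close>

lemma continuous_on_quadratic_dmul:
  "continuous_on S (\<lambda>x. (a + c *\<^sub>R dmul \<delta> x) \<bullet> (A *v (a + c *\<^sub>R dmul \<delta> x)))" for A :: "real^'n^'n"
  by (simp add: dmul_def inner_vec_def matrix_vector_mult_def) (intro continuous_intros)

lemma nn_integral_gauss_dmul:
  fixes A :: "real ^ 'n::{finite,wellorder} ^ 'n::{finite,wellorder}"
  assumes sym: "transpose A = A" and pos: "pos_def_real A" and k: "k > 0" and \<delta>: "\<forall>i. \<delta> i > 0"
  shows "(\<integral>\<^sup>+x. ennreal (exp (- (2 * pi / real k) *
        ((m + real k *\<^sub>R dmul \<delta> x) \<bullet> (A *v (m + real k *\<^sub>R dmul \<delta> x))))) \<partial>lborel)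
    = ennreal (1 / ((2 * real k) powr (real CARD('n) / 2) * det A powr (1/2) * real (\<Prod>i\<in>UNIV. \<delta> i)))"
proof -
  \<comment> \<open>Expanding the square gives (2 pi / k) k^2 = 2 pi k; splitting off pi leaves 2k,
    shared as sqrt(2k) between the two copies of \<open>D\<close>.\<close>
  define D :: "real ^ 'n::_ ^ 'n::_" where "D = (\<chi> i j. if i = j then sqrt (2 * real k) * real (\<delta> i) else 0)"
  define A' where "A' = D ** A ** D"
  have Dv: "D *v x = sqrt (2 * real k) *\<^sub>R dmul \<delta> x" for x
    by (simp add: D_def vec_eq_iff matrix_vector_mult_def dmul_def if_distrib if_distribR cong: if_cong)
  have DT: "transpose D = D"
    by (auto simp: D_def transpose_def vec_eq_iff)
  have quad: "x \<bullet> (A' *v x) = 2 * real k * (dmul \<delta> x \<bullet> (A *v dmul \<delta> x))" for x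
  proof -
    have "x \<bullet> (A' *v x) = x \<bullet> (D *v (A *v (D *v x)))"
      by (simp add: A'_def matrix_vector_mul_assoc matrix_mul_assoc)
    also have "\<dots> = (D *v x) \<bullet> (A *v (D *v x))"
      by (metis DT dot_lmul_matrix transpose_matrix_vector)
    finally show ?thesis using k
      by (simp add: Dv matrix_vector_mult_scaleR)
  qed
  have "transpose A' = A'"
    by (simp add: A'_def matrix_transpose_mul DT sym matrix_mul_assoc)
  moreover have "pos_def_real A'"
    unfolding pos_def_real_def quad
  proof (intro allI impI)
    fix v :: "real ^ 'n::_" assume "v \<noteq> 0"
    then have "dmul \<delta> v \<noteq> 0" using \<delta> by (auto simp: dmul_def vec_eq_iff simp flip: neq0_conv)
    then show "0 < 2 * real k * (dmul \<delta> v \<bullet> (A *v dmul \<delta> v))"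
      using pos k by (simp add: pos_def_real_def)
  qed
  ultimately have G: "(\<integral>\<^sup>+x. ennreal (exp (- pi * (x \<bullet> (A' *v x)))) \<partial>lborel) = ennreal (1 / sqrt (det A'))"
    by (rule nn_integral_gauss)
  have "det D = (\<Prod>i\<in>UNIV. sqrt (2 * real k) * real (\<delta> i))"
    by (subst det_diagonal) (auto simp: D_def)
  also have "\<dots> = sqrt (2 * real k) ^ CARD('n) * real (\<Prod>i\<in>UNIV. \<delta> i)"
    by (simp add: prod.distrib)
  also have "sqrt (2 * real k) ^ CARD('n) = (2 * real k) powr (real CARD('n) / 2)"
    using k by (simp add: powr_powr flip: powr_half_sqrt powr_realpow)
  finally have detD: "det D = (2 * real k) powr (real CARD('n) / 2) * real (\<Prod>i\<in>UNIV. \<delta> i)" .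
  have "sqrt (det A') = sqrt ((det D)\<^sup>2 * det A)"
    by (simp add: A'_def det_mul power2_eq_square mult_ac)
  also have "\<dots> = det D * det A powr (1/2)"
    using pos_def_real_det_pos[OF sym pos]
    by (simp add: real_sqrt_mult powr_half_sqrt detD prod_nonneg)
  finally have detA': "sqrt (det A') = (2 * real k) powr (real CARD('n) / 2) * det A powr (1/2) * real (\<Prod>i\<in>UNIV. \<delta> i)"
    by (simp add: detD mult_ac)
  \<comment> \<open>The solution of m + k delta a = 0: shifting by it centres the Gaussian at the
    origin.\<close>
  define a :: "real ^ 'n::_" where "a = (\<chi> i. - m $ i / (real k * real (\<delta> i)))"
  define \<phi> where "\<phi> x = ennreal (exp (- (2 * pi / real k) *
        ((m + real k *\<^sub>R dmul \<delta> x) \<bullet> (A *v (m + real k *\<^sub>R dmul \<delta> x)))))" for x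
  have "continuous_on UNIV (\<lambda>x. exp (- (2 * pi / real k) *
        ((m + real k *\<^sub>R dmul \<delta> x) \<bullet> (A *v (m + real k *\<^sub>R dmul \<delta> x)))))"
    by (intro continuous_intros continuous_on_quadratic_dmul)
  then have "\<phi> \<in> borel_measurable borel"
    unfolding \<phi>_def by (intro measurable_compose[OF borel_measurable_continuous_onI measurable_ennreal])
  then have "(\<integral>\<^sup>+x. \<phi> x \<partial>lborel) = (\<integral>\<^sup>+x. \<phi> (x + a) \<partial>lborel)"
    by (rule nn_integral_lborel_shift[symmetric])
  also have "\<dots> = (\<integral>\<^sup>+x. ennreal (exp (- pi * (x \<bullet> (A' *v x)))) \<partial>lborel)"
  proof (rule nn_integral_cong)
    fix x
    have "m + real k *\<^sub>R dmul \<delta> (x + a) = real k *\<^sub>R dmul \<delta> x"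
      using k \<delta> by (auto simp: a_def dmul_def vec_eq_iff field_simps simp flip: neq0_conv)
    then show "\<phi> (x + a) = ennreal (exp (- pi * (x \<bullet> (A' *v x))))"
      using k by (simp add: \<phi>_def quad matrix_vector_mult_scaleR)
  qed
  finally show ?thesis unfolding G detA' \<phi>_def .
qed

subsection \<open>Unitarity\<close>

lemma heat_term_add_real2c:
  "heat_term \<Omega> t \<mu> (real2c \<eta> + z) = heat_term \<Omega> t \<mu> z * exp (2 * pi * \<i> * complex_of_real (int2r \<mu> \<bullet> \<eta>))"
proof -
  have "cdot (int2c \<mu>) (real2c \<eta> + z) = complex_of_real (int2r \<mu> \<bullet> \<eta>) + cdot (int2c \<mu>) z"
    by (simp add: cdot_def int2c_def real2c_def inner_vec_def distrib_left sum.distrib)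
  then show ?thesis by (simp add: heat_term_def distrib_left exp_add mult_ac)
qed

text \<open>The weight supplies exactly the term quadratic in \<open>x\<close> that completes the
  square; symmetry of \<open>Im_mat \<Omega>\<close> merges the two cross terms.\<close>

lemma norm_heat_term_weight:
  fixes \<Omega> :: "complex ^ 'n ^ 'n"
  assumes sym: "transpose \<Omega> = \<Omega>" and k: "k > 0"
  shows "(norm (heat_term \<Omega> (1 / real k) \<mu> (\<Omega> *v real2c x)))\<^sup>2 * exp (- 2 * pi * real k * (x \<bullet> (Im_mat \<Omega> *v x)))
    = exp (- (2 * pi / real k) * ((int2r \<mu> + real k *\<^sub>R x) \<bullet> (Im_mat \<Omega> *v (int2r \<mu> + real k *\<^sub>R x))))"
proof -
  define A where "A = Im_mat \<Omega>"
  have "x \<bullet> (A *v int2r \<mu>) = int2r \<mu> \<bullet> (A *v x)"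
    by (rule inner_sym_matrix) (simp add: A_def transpose_Im_mat sym)
  then have "(int2r \<mu> + real k *\<^sub>R x) \<bullet> (A *v (int2r \<mu> + real k *\<^sub>R x)) =
      int2r \<mu> \<bullet> (A *v int2r \<mu>) + 2 * real k * (int2r \<mu> \<bullet> (A *v x)) + (real k)\<^sup>2 * (x \<bullet> (A *v x))"
    by (simp add: matrix_vector_right_distrib matrix_vector_mult_scaleR inner_add_left inner_add_right power2_eq_square algebra_simps)
  moreover have "- (2 * pi / real k) * (a + 2 * real k * b + (real k)\<^sup>2 * c) =
      2 * (- pi * (1 / real k) * a - 2 * pi * b) + - 2 * pi * real k * c" for a b c
    using k by (simp add: field_simps power2_eq_square)
  moreover have "(exp a)\<^sup>2 * exp b = exp (2 * a + b)" for a b :: real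
    by (simp add: exp_double exp_add)
  ultimately show ?thesis
    by (simp only: norm_heat_term Im_vec_mult_real2c A_def[symmetric])
qed

lemma continuous_on_heat_term:
  fixes \<Omega> :: "complex ^ 'n ^ 'n"
  shows "continuous_on S (\<lambda>q. heat_term \<Omega> t \<mu> (real2c (fst q) + \<Omega> *v real2c (dmul \<delta> (snd q))))"
  unfolding heat_term_def
  by (simp add: cdot_def real2c_def dmul_def matrix_vector_mult_def) (intro continuous_intros)

text \<open>Up to the normalising constant, the squared norm of a single heat term in
  \<open>H_inner\<close>, once the real torus variable has been integrated out.\<close>

definition cell_integral :: "nat \<Rightarrow> real ^ 'n ^ 'n \<Rightarrow> ('n::finite \<Rightarrow> nat) \<Rightarrow> int ^ 'n \<Rightarrow> real" where
  "cell_integral k A \<delta> \<mu> = (LINT \<xi>|lborel. indicator (cbox 0 One) \<xi> *\<^sub>R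
     exp (- (2 * pi / real k) * ((int2r \<mu> + real k *\<^sub>R dmul \<delta> \<xi>) \<bullet> (A *v (int2r \<mu> + real k *\<^sub>R dmul \<delta> \<xi>)))))"

lemma has_sum_cell_integral:
  fixes A :: "real ^ 'n::{finite,wellorder} ^ 'n::{finite,wellorder}"
  assumes sym: "transpose A = A" and pos: "pos_def_real A" and k: "k > 0" and \<delta>: "\<forall>i. \<delta> i > 0"
  shows "((\<lambda>p. cell_integral k A \<delta> (m + of_nat k *s dmul \<delta> p)) has_sum
     1 / ((2 * real k) powr (real CARD('n) / 2) * det A powr (1/2) * real (\<Prod>i\<in>UNIV. \<delta> i))) UNIV"
proof -
  define c where "c = 1 / ((2 * real k) powr (real CARD('n) / 2) * det A powr (1/2) * real (\<Prod>i\<in>UNIV. \<delta> i))"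
  have c: "c \<ge> 0" by (simp add: c_def prod_nonneg)
  define \<phi> where "\<phi> x = exp (- (2 * pi / real k) *
        ((int2r m + real k *\<^sub>R dmul \<delta> x) \<bullet> (A *v (int2r m + real k *\<^sub>R dmul \<delta> x))))" for x
  define J where "J p = cell_integral k A \<delta> (m + of_nat k *s dmul \<delta> p)" for p
  have cont: "continuous_on S \<phi>" for S
    unfolding \<phi>_def by (intro continuous_intros continuous_on_quadratic_dmul)
  have [measurable]: "\<phi> \<in> borel_measurable borel"
    using cont by (rule borel_measurable_continuous_onI)
  \<comment> \<open>Moving the index within its class is a unit translation of the cell, so the
    cells of one class tile the space.\<close>
  have shift: "int2r (m + of_nat k *s dmul \<delta> p) + real k *\<^sub>R dmul \<delta> x = int2r m + real k *\<^sub>R dmul \<delta> (x + int2r p)" for p x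
    by (simp add: vec_eq_iff dmul_def algebra_simps)
  have J: "J p = (LINT \<xi>|lborel. indicator (cbox 0 One) \<xi> *\<^sub>R \<phi> (\<xi> + int2r p))" for p
    by (simp only: J_def cell_integral_def shift \<phi>_def)
  have int: "integrable lborel (\<lambda>\<xi>. indicator (cbox 0 One) \<xi> *\<^sub>R \<phi> (\<xi> + int2r p))" for p
    by (intro borel_integrable_compact continuous_on_compose2[OF cont[of UNIV]] continuous_intros) auto
  have J_nonneg: "J p \<ge> 0" for p
    unfolding J by (intro integral_nonneg_AE) (simp add: \<phi>_def)
  have "ennreal (J p) = (\<integral>\<^sup>+\<xi>. ennreal (\<phi> (\<xi> + int2r p)) * indicator (cbox 0 One) \<xi> \<partial>lborel)" for p
    unfolding J by (subst nn_integral_eq_integral[OF int, symmetric])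
      (auto simp: \<phi>_def indicator_def intro!: nn_integral_cong)
  then have "(\<integral>\<^sup>+p. ennreal (J p) \<partial>count_space UNIV) = (\<integral>\<^sup>+x. ennreal (\<phi> x) \<partial>lborel)"
    by (simp add: nn_integral_unfold_lattice[of "\<lambda>x. ennreal (\<phi> x)"])
  also have "\<dots> = ennreal c"
    unfolding \<phi>_def c_def by (rule nn_integral_gauss_dmul[OF assms])
  finally have sum: "(\<integral>\<^sup>+p. ennreal (J p) \<partial>count_space UNIV) = ennreal c" .
  have intJ: "integrable (count_space UNIV) J"
    by (rule integrableI_nn_integral_finite[OF _ _ sum]) (use J_nonneg in auto)
  have "infsum J UNIV = (LINT p|count_space UNIV. J p)"
    using integral_count_space_eq_infsum[OF intJ] by simp
  also have "\<dots> = c"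
    using sum c J_nonneg by (subst integral_eq_nn_integral) auto
  finally have "infsum J UNIV = c" .
  moreover have "J summable_on UNIV"
    using intJ unfolding integrable_count_space_iff_summable_on by (rule abs_summable_summable)
  ultimately show ?thesis
    unfolding J_def c_def using has_sum_infsum by metis
qed

text \<open>Coordinatewise division with remainder: representatives are the remainders and
  \<open>p\<close> collects the quotients. Summability permits the regrouping.\<close>

lemma infsum_lattice_classes:
  fixes F :: "int ^ 'n \<Rightarrow> complex"
  assumes F: "F summable_on UNIV" and k: "k > 0" and \<delta>: "\<forall>i. \<delta> i > 0"
  shows "infsum F UNIV = (\<Sum>m\<in>reps k \<delta>. \<Sum>\<^sub>\<infinity>p. F (m + of_nat k *s dmul \<delta> p))"
proof -
  define h :: "(int ^ 'n) \<times> (int ^ 'n) \<Rightarrow> int ^ 'n" where "h = (\<lambda>(m, p). m + of_nat k *s dmul \<delta> p)"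
  have "bij_betw h (reps k \<delta> \<times> UNIV) UNIV"
  proof (rule bij_betwI')
    fix x y assume "x \<in> reps k \<delta> \<times> (UNIV :: (int^'n) set)" "y \<in> reps k \<delta> \<times> (UNIV :: (int^'n) set)"
    then obtain m p n q where xy: "x = (m, p)" "y = (n, q)" "m \<in> reps k \<delta>" "n \<in> reps k \<delta>" by auto
    show "(h x = h y) = (x = y)"
    proof
      assume eq: "h x = h y"
      have red: "h (r, s) $ i mod int (k * \<delta> i) = r $ i" if "r \<in> reps k \<delta>" for r s i
        using that by (simp add: h_def dmul_def reps_def mult.assoc[symmetric])
      have "m = n" using eq red[OF xy(3)] red[OF xy(4)] by (metis vec_eq_iff xy(1,2))
      moreover have "p = q"
        using eq \<open>m = n\<close> k \<delta> by (auto simp: xy h_def dmul_def vec_eq_iff simp flip: neq0_conv)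
      ultimately show "x = y" by (simp add: xy)
    qed simp
  next
    fix \<mu> :: "int ^ 'n"
    obtain p where "\<mu> = reduce k \<delta> \<mu> + of_nat k *s dmul \<delta> p"
      using same_class_reduce same_class_iff by blast
    then have "\<mu> = h (reduce k \<delta> \<mu>, p)" by (simp add: h_def)
    then show "\<exists>x\<in>reps k \<delta> \<times> UNIV. \<mu> = h x"
      using reduce_in_reps[OF k \<delta>] by blast
  qed simp
  then have "infsum F UNIV = infsum (\<lambda>x. F (h x)) (reps k \<delta> \<times> UNIV)"
    and "(\<lambda>x. F (h x)) summable_on (reps k \<delta> \<times> UNIV)"
    using F by (simp_all add: infsum_reindex_bij_betw summable_on_reindex_bij_betw)
  then show ?thesis
    by (simp add: finite_reps h_def flip: infsum_Sigma_banach)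
qed

text \<open>The sum-integral of \<open>H\<close> is evaluated in both orders: summing over index
  pairs first gives \<open>H_inner\<close>, integrating first leaves the diagonal series
  \<open>S\<close>.\<close>

lemma H_inner_C_ab_eq_infsum:
  fixes \<Omega> :: "complex ^ 'n::{finite,wellorder} ^ 'n::{finite,wellorder}"
  assumes sym: "transpose \<Omega> = \<Omega>" and pos: "pos_def_real (Im_mat \<Omega>)" and k: "k > 0"
    and f: "\<And>\<mu>. norm (f \<mu>) \<le> F" and g: "\<And>\<mu>. norm (g \<mu>) \<le> G"
    and K: "K = (2 * real k) powr (real CARD('n) / 2) * det (Im_mat \<Omega>) powr (1/2) * real (\<Prod>i\<in>UNIV. \<delta> i)"
  defines "S \<equiv> \<lambda>\<mu>. cnj (f \<mu>) * g \<mu> * complex_of_real (K * cell_integral k (Im_mat \<Omega>) \<delta> \<mu>)"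
  shows "S summable_on UNIV"
    and "H_inner k \<Omega> \<delta> (C_ab \<Omega> (1 / real k) f) (C_ab \<Omega> (1 / real k) g) = infsum S UNIV"
proof -
  define t where "t = 1 / real k"
  have t: "t > 0" using k by (simp add: t_def)
  define B :: "((real^'n::_) \<times> (real^'n::_)) set" where "B = cbox 0 One \<times> cbox 0 One"
  define Z where "Z q = real2c (fst q) + \<Omega> *v real2c (dmul \<delta> (snd q))" for q :: "(real^'n::_) \<times> (real^'n::_)"
  define W where "W \<xi> = exp (- 2 * pi * real k * (dmul \<delta> \<xi> \<bullet> (Im_mat \<Omega> *v dmul \<delta> \<xi>)))" for \<xi> :: "real^'n::_"
  \<comment> \<open>One term of the product of the two series; \<open>p\<close> pairs an index of
    the conjugated series with one of the other.\<close>
  define H where "H p q = indicator B q *\<^sub>R (cnj (f (fst p) * heat_term \<Omega> t (fst p) (Z q)) *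
      (g (snd p) * heat_term \<Omega> t (snd p) (Z q)) * complex_of_real (K * W (snd q)))" for p q
  let ?M = "count_space (UNIV :: ((int^'n::_) \<times> (int^'n::_)) set)"
  interpret pair_sigma_finite ?M "lborel :: ((real^'n::_) \<times> (real^'n::_)) measure"
    by (intro pair_sigma_finite.intro sigma_finite_measure_count_space) (rule sigma_finite_lborel)
  have compact_B: "compact B" unfolding B_def by (intro compact_Times compact_cbox)
  have K_nonneg: "K \<ge> 0" by (simp add: K prod_nonneg)
  have cont_W: "continuous_on T W" for T
  proof -
    have "continuous_on T (\<lambda>x. dmul \<delta> x \<bullet> (Im_mat \<Omega> *v dmul \<delta> x))"
      using continuous_on_quadratic_dmul[of T 0 1 \<delta> "Im_mat \<Omega>"] by simp
    then show ?thesis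
      unfolding W_def by (intro continuous_on_exp continuous_on_mult continuous_on_const)
  qed
  have W_le: "W \<xi> \<le> 1" "W \<xi> \<ge> 0" for \<xi>
  proof -
    have "dmul \<delta> \<xi> \<bullet> (Im_mat \<Omega> *v dmul \<delta> \<xi>) \<ge> 0"
      using pos by (cases "dmul \<delta> \<xi> = 0") (auto simp: pos_def_real_def less_imp_le)
    then show "W \<xi> \<le> 1" "W \<xi> \<ge> 0" by (simp_all add: W_def)
  qed
  have "continuous_on B (\<lambda>q. Im_vec (Z q))"
    unfolding Z_def Im_vec_add Im_vec_real2c Im_vec_mult_real2c
    by (simp add: matrix_vector_mult_def dmul_def) (intro continuous_intros)
  then have "bounded ((\<lambda>q. Im_vec (Z q)) ` B)"
    using compact_B by (intro compact_imp_bounded compact_continuous_image)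
  \<comment> \<open>Compactness of the double cube bounds Im z, so a single Gaussian bound serves
    for all integration points.\<close>
  then obtain R where R: "R > 0" "\<And>q. q \<in> B \<Longrightarrow> norm (Im_vec (Z q)) \<le> R"
    by (auto simp: bounded_pos)
  obtain a C where aC: "a > 0" "C > 0"
    "\<And>\<mu> z. norm (Im_vec z) \<le> R \<Longrightarrow> norm (heat_term \<Omega> t \<mu> z) \<le> C * exp (- a * (norm (int2r \<mu>))\<^sup>2)"
    using heat_term_bound[OF pos t less_imp_le[OF R(1)]] by metis
  define e where "e \<mu> = exp (- a * (norm (int2r \<mu>))\<^sup>2)" for \<mu> :: "int^'n::_"
  have FG: "F \<ge> 0" "G \<ge> 0" using f g norm_ge_zero order_trans by blast+
  define D where "D = F * C * (G * C) * K"
  have H_bound: "norm (H p q) \<le> indicator B q *\<^sub>R (D * (e (fst p) * e (snd p)))" for p q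
  proof (cases "q \<in> B")
    case True
    have "norm (f (fst p) * heat_term \<Omega> t (fst p) (Z q)) \<le> F * (C * e (fst p))"
      "norm (g (snd p) * heat_term \<Omega> t (snd p) (Z q)) \<le> G * (C * e (snd p))"
      unfolding norm_mult e_def by (intro mult_mono f g aC R True FG norm_ge_zero)+
    moreover have "norm (complex_of_real (K * W (snd q))) \<le> K * 1"
      using W_le[of "snd q"] K_nonneg by (simp add: norm_mult mult_left_le)
    ultimately have "norm (H p q) \<le> (F * (C * e (fst p))) * (G * (C * e (snd p))) * (K * 1)"
      using True FG aC(2) unfolding H_def norm_mult norm_scaleR complex_mod_cnj
      by (auto intro!: mult_mono mult_nonneg_nonneg simp: e_def K_nonneg)
    then show ?thesis using True by (simp add: D_def mult_ac)
  qed (simp add: H_def)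
  have H_int: "integrable lborel (H p)" for p
  proof -
    have "continuous_on B (\<lambda>q. W (snd q))"
      by (rule continuous_on_compose2[OF cont_W[of UNIV]]) (auto intro: continuous_intros)
    then show ?thesis
      unfolding H_def Z_def
      by (intro borel_integrable_compact compact_B continuous_intros continuous_on_heat_term)
  qed
  have "integrable (count_space UNIV) e"
    unfolding e_def integrable_count_space_iff_summable_on using lattice_gauss_summable[OF aC(1)] by simp
  then have "integrable ?M (\<lambda>(\<mu>, \<nu>). e \<mu> * e \<nu>)"
    using abs_summable_on_product[where f = e and g = e and A = UNIV and B = UNIV] by (simp add: abs_summable_on_def)
  then have e_int: "integrable ?M (\<lambda>p. c * (e (fst p) * e (snd p)))" for c
    by (simp add: case_prod_unfold)
  \<comment> \<open>The dominating function factors as D e(mu) e(nu) on a set of finite measure, and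
    \<open>e\<close> is summable over the lattice.\<close>
  have H_pair: "integrable (?M \<Otimes>\<^sub>M lborel) (case_prod H)"
  proof (rule Fubini_integrable)
    show "case_prod H \<in> borel_measurable (?M \<Otimes>\<^sub>M lborel)"
      using borel_measurable_integrable[OF H_int]
      by (intro measurable_pair_measure_countable1) auto
    have B_int: "integrable lborel (\<lambda>q. indicator B q *\<^sub>R c)" for c :: real
      by (intro borel_integrable_compact compact_B continuous_intros)
    show "integrable ?M (\<lambda>p. LINT q|lborel. norm (case_prod H (p, q)))"
    proof (rule Bochner_Integration.integrable_bound[OF e_int[of "D * measure lborel B"]])
      show "AE p in ?M. norm (LINT q|lborel. norm (case_prod H (p, q))) \<le> norm (D * measure lborel B * (e (fst p) * e (snd p)))"
      proof (rule AE_I2)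
        fix p
        have "(LINT q|lborel. norm (H p q)) \<le> (LINT q|lborel. indicator B q *\<^sub>R (D * (e (fst p) * e (snd p))))"
          by (intro integral_mono integrable_norm H_int B_int H_bound)
        also have "\<dots> = D * measure lborel B * (e (fst p) * e (snd p))"
          by (simp add: mult_ac)
        finally show "norm (LINT q|lborel. norm (case_prod H (p, q))) \<le> norm (D * measure lborel B * (e (fst p) * e (snd p)))"
          by simp
      qed
    qed simp
    show "AE p in ?M. integrable lborel (\<lambda>q. case_prod H (p, q))"
      using H_int by simp
  qed
  have series: "integrable (count_space UNIV) (\<lambda>\<mu>. b \<mu> * heat_term \<Omega> t \<mu> z)"
    if "\<And>\<mu>. norm (b \<mu>) \<le> M" for b M z
    unfolding integrable_count_space_iff_summable_on
    by (rule heat_series_abs_summable[OF pos t that])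
  have sum_H: "(LINT p|?M. H p q) = indicator B q *\<^sub>R (cnj (C_ab \<Omega> t f (Z q)) * C_ab \<Omega> t g (Z q) * complex_of_real (K * W (snd q)))"
    for q
  proof -
    let ?u = "\<lambda>\<mu>. cnj (f \<mu> * heat_term \<Omega> t \<mu> (Z q))" and ?v = "\<lambda>\<mu>. g \<mu> * heat_term \<Omega> t \<mu> (Z q)"
    have u: "integrable (count_space UNIV) ?u" and v: "integrable (count_space UNIV) ?v"
      using series[where b = f and z = "Z q", OF f] series[where b = g and z = "Z q", OF g]
      by (simp_all only: complex_integrable_cnj)
    have "(LINT p|?M. ?u (fst p) * ?v (snd p)) = (LINT \<mu>|count_space UNIV. ?u \<mu>) * (LINT \<mu>|count_space UNIV. ?v \<mu>)"
      using infsetsum_product[where f = ?u and g = ?v and A = UNIV and B = UNIV] u v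
      by (simp add: abs_summable_on_def infsetsum_def case_prod_unfold)
    also have "(LINT \<mu>|count_space UNIV. ?u \<mu>) = cnj (C_ab \<Omega> t f (Z q))"
      unfolding Bochner_Integration.integral_cnj C_ab_heat_term integral_count_space_eq_infsum[OF series[where b = f, OF f]] ..
    also have "(LINT \<mu>|count_space UNIV. ?v \<mu>) = C_ab \<Omega> t g (Z q)"
      unfolding C_ab_heat_term integral_count_space_eq_infsum[OF series[where b = g, OF g]] ..
    finally have "(LINT p|?M. ?u (fst p) * ?v (snd p)) = cnj (C_ab \<Omega> t f (Z q)) * C_ab \<Omega> t g (Z q)" .
    then show ?thesis
      unfolding H_def integral_scaleR_right integral_mult_left_zero by simp
  qed
  have int_H: "(LINT q|lborel. H p q) = (if fst p = snd p then S (fst p) else 0)" for p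
  proof -
    obtain \<mu> \<nu> where p: "p = (\<mu>, \<nu>)" by (cases p)
    define w where "w \<xi> = cnj (f \<mu>) * g \<nu> * complex_of_real (K * W \<xi>) *
       (cnj (heat_term \<Omega> t \<mu> (\<Omega> *v real2c (dmul \<delta> \<xi>))) * heat_term \<Omega> t \<nu> (\<Omega> *v real2c (dmul \<delta> \<xi>)))" for \<xi>
    \<comment> \<open>All dependence on \<eta> sits in the character of index \<nu> - \<mu>, whose
      integral over the cube is the Kronecker delta.\<close>
    have H: "H p (\<eta>, \<xi>) = (indicator (cbox 0 One) \<xi> *\<^sub>R w \<xi>) *
        (indicator (cbox 0 One) \<eta> *\<^sub>R exp (2 * pi * \<i> * complex_of_real (int2r (\<nu> - \<mu>) \<bullet> \<eta>)))" for \<eta> \<xi>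
    proof -
      have "cnj (exp (2 * pi * \<i> * complex_of_real (int2r \<mu> \<bullet> \<eta>))) * exp (2 * pi * \<i> * complex_of_real (int2r \<nu> \<bullet> \<eta>))
          = exp (2 * pi * \<i> * complex_of_real (int2r (\<nu> - \<mu>) \<bullet> \<eta>))"
      proof -
        have "int2r (\<nu> - \<mu>) \<bullet> \<eta> = int2r \<nu> \<bullet> \<eta> - int2r \<mu> \<bullet> \<eta>"
          by (simp add: inner_vec_def left_diff_distrib sum_subtractf)
        then show ?thesis by (simp add: exp_cnj right_diff_distrib flip: exp_add)
      qed
      then show ?thesis
        by (auto simp: H_def p Z_def B_def w_def heat_term_add_real2c indicator_def mult_ac)
    qed
    have "(LINT q|lborel. H p q) = (LINT \<xi>|lborel. LINT \<eta>|lborel. H p (\<eta>, \<xi>))"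
      using lborel_pair.integral_snd[of "\<lambda>\<eta> \<xi>. H p (\<eta>, \<xi>)"] H_int[of p] by (simp add: lborel_prod)
    also have "\<dots> = (LINT \<xi>|lborel. (indicator (cbox 0 One) \<xi> *\<^sub>R w \<xi>) * (if \<mu> = \<nu> then 1 else 0))"
      unfolding H integral_mult_right_zero integral_exp_unit_cube by (simp add: eq_commute[of \<mu>])
    also have "\<dots> = (if \<mu> = \<nu> then S \<mu> else 0)"
    proof (cases "\<mu> = \<nu>")
      case True
      have norm_sq: "(complex_of_real (norm x))\<^sup>2 = x * cnj x" for x
        by (simp add: complex_norm_square flip: of_real_power)
      have "indicator (cbox 0 One) \<xi> *\<^sub>R w \<xi> = cnj (f \<mu>) * g \<mu> * complex_of_real (K * (indicator (cbox 0 One) \<xi> *\<^sub>R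
         exp (- (2 * pi / real k) * ((int2r \<mu> + real k *\<^sub>R dmul \<delta> \<xi>) \<bullet> (Im_mat \<Omega> *v (int2r \<mu> + real k *\<^sub>R dmul \<delta> \<xi>))))))" for \<xi>
        unfolding norm_heat_term_weight[OF sym k, symmetric]
        by (simp add: w_def True W_def t_def norm_sq mult_ac scaleR_conv_of_real)
      then have "(LINT \<xi>|lborel. indicator (cbox 0 One) \<xi> *\<^sub>R w \<xi>) = S \<mu>"
        by (simp only: S_def cell_integral_def integral_mult_right_zero integral_complex_of_real)
      then show ?thesis using True by simp
    qed simp
    finally show ?thesis by (simp add: p)
  qed
  have "integrable ?M (\<lambda>p. LINT q|lborel. H p q)"
    by (rule integrable_fst[OF H_pair])
  \<comment> \<open>Fubini also yields integrability of the inner integral, so summability of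
    \<open>S\<close> needs no separate estimate.\<close>
  then have S_int: "integrable ?M (\<lambda>p. if fst p = snd p then S (fst p) else 0)"
    unfolding int_H .
  define d where "d = (\<lambda>\<mu>::int^'n::_. (\<mu>, \<mu>))"
  have inj_d: "inj d" by (simp add: d_def inj_def)
  have "(\<lambda>p. if fst p = snd p then S (fst p) else 0) summable_on UNIV"
    using S_int unfolding integrable_count_space_iff_summable_on by (rule abs_summable_summable)
  then have "(\<lambda>p. if fst p = snd p then S (fst p) else 0) summable_on range d"
    by (rule summable_on_subset_banach) simp
  then show "S summable_on UNIV"
    unfolding summable_on_reindex[OF inj_d] by (simp add: o_def d_def)
  have "H_inner k \<Omega> \<delta> (C_ab \<Omega> t f) (C_ab \<Omega> t g) = (LINT q|lborel. LINT p|?M. H p q)"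
    unfolding H_inner_def set_lebesgue_integral_def sum_H
    by (simp add: Let_def Z_def W_def B_def K mult_ac)
  also have "\<dots> = (LINT p|?M. LINT q|lborel. H p q)"
    by (rule Fubini_integral[OF H_pair])
  also have "\<dots> = infsum (\<lambda>p. if fst p = snd p then S (fst p) else 0) UNIV"
    unfolding int_H by (rule integral_count_space_eq_infsum[OF S_int])
  also have "\<dots> = infsum (\<lambda>p. S (fst p)) (range d)"
    by (rule infsum_cong_neutral) (auto simp: d_def)
  also have "\<dots> = infsum S UNIV"
    unfolding infsum_reindex[OF inj_d] by (simp add: o_def d_def)
  finally show "H_inner k \<Omega> \<delta> (C_ab \<Omega> (1 / real k) f) (C_ab \<Omega> (1 / real k) g) = infsum S UNIV"
    by (simp only: t_def)
qed

text \<open>On each residue class both coefficient functions are constant and factor out, and the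
  cell integrals of the class add up to 1 / K, cancelling the constant.\<close>

lemma C_ab_isometry:
  fixes \<Omega> :: "complex ^ 'n::{finite,wellorder} ^ 'n::{finite,wellorder}"
  assumes sym: "transpose \<Omega> = \<Omega>" and pos: "pos_def_real (Im_mat \<Omega>)" and k: "k > 0" and \<delta>: "\<forall>i. \<delta> i > 0"
    and f: "f \<in> I_space k \<delta>" and g: "g \<in> I_space k \<delta>"
  shows "H_inner k \<Omega> \<delta> (C_ab \<Omega> (1 / real k) f) (C_ab \<Omega> (1 / real k) g) = I_inner k \<delta> f g"
proof -
  define K where "K = (2 * real k) powr (real CARD('n) / 2) * det (Im_mat \<Omega>) powr (1/2) * real (\<Prod>i\<in>UNIV. \<delta> i)"
  define S where "S = (\<lambda>\<mu>. cnj (f \<mu>) * g \<mu> * complex_of_real (K * cell_integral k (Im_mat \<Omega>) \<delta> \<mu>))"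
  obtain F where F: "\<And>\<mu>. norm (f \<mu>) \<le> F" using I_space_bounded[OF k \<delta> f] by blast
  obtain G where G: "\<And>\<mu>. norm (g \<mu>) \<le> G" using I_space_bounded[OF k \<delta> g] by blast
  note symA = transpose_Im_mat[OF sym]
  have K: "K \<noteq> 0"
    using pos_def_real_det_pos[OF symA pos] k \<delta> by (auto simp: K_def simp flip: neq0_conv)
  have core: "S summable_on UNIV"
    "H_inner k \<Omega> \<delta> (C_ab \<Omega> (1 / real k) f) (C_ab \<Omega> (1 / real k) g) = infsum S UNIV"
    unfolding S_def by (rule H_inner_C_ab_eq_infsum[OF sym pos k F G K_def])+
  have "H_inner k \<Omega> \<delta> (C_ab \<Omega> (1 / real k) f) (C_ab \<Omega> (1 / real k) g) =
      (\<Sum>m\<in>reps k \<delta>. \<Sum>\<^sub>\<infinity>p. S (m + of_nat k *s dmul \<delta> p))"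
    unfolding core(2) by (rule infsum_lattice_classes[OF core(1) k \<delta>])
  also have "\<dots> = (\<Sum>m\<in>reps k \<delta>. cnj (f m) * g m)"
  proof (rule sum.cong)
    fix m
    define J where "J p = cell_integral k (Im_mat \<Omega>) \<delta> (m + of_nat k *s dmul \<delta> p)" for p
    have "f (m + of_nat k *s dmul \<delta> p) = f m" "g (m + of_nat k *s dmul \<delta> p) = g m" for p
      using I_space_periodic[OF k \<delta>] f g same_class_iff by blast+
    then have S: "S (m + of_nat k *s dmul \<delta> p) = cnj (f m) * g m * complex_of_real K * complex_of_real (J p)" for p
      by (simp add: S_def J_def)
    have "(J has_sum 1 / K) UNIV"
      unfolding J_def K_def by (rule has_sum_cell_integral[OF symA pos k \<delta>])
    then have "((\<lambda>p. S (m + of_nat k *s dmul \<delta> p)) has_sum cnj (f m) * g m * complex_of_real K * complex_of_real (1 / K)) UNIV"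
      unfolding S by (intro has_sum_cmult_right has_sum_of_real)
    then show "(\<Sum>\<^sub>\<infinity>p. S (m + of_nat k *s dmul \<delta> p)) = cnj (f m) * g m"
      using K by (simp add: infsumI)
  qed simp
  finally show ?thesis by (simp add: I_inner_def)
qed

lemma inj_on_C_ab:
  fixes \<Omega> :: "complex ^ 'n::{finite,wellorder} ^ 'n::{finite,wellorder}"
  assumes sym: "transpose \<Omega> = \<Omega>" and pos: "pos_def_real (Im_mat \<Omega>)" and k: "k > 0" and \<delta>: "\<forall>i. \<delta> i > 0"
  shows "inj_on (C_ab \<Omega> (1 / real k)) (I_space k \<delta>)"
proof (rule inj_onI)
  fix f g assume f: "f \<in> I_space k \<delta>" and g: "g \<in> I_space k \<delta>"
    and eq: "C_ab \<Omega> (1 / real k) f = C_ab \<Omega> (1 / real k) g"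
  note iso = C_ab_isometry[OF assms]
  \<comment> \<open>Equal images make these inner products agree pairwise, so the squared norm of f
    - g expands to 0 without applying \<open>C_ab\<close> to a difference.\<close>
  have "I_inner k \<delta> f f = I_inner k \<delta> f g" "I_inner k \<delta> g f = I_inner k \<delta> g g"
    using iso[OF f f] iso[OF f g] iso[OF g f] iso[OF g g] eq by simp_all
  then have "(\<Sum>m\<in>reps k \<delta>. cnj (f m - g m) * (f m - g m)) = 0"
    by (simp add: I_inner_def algebra_simps sum.distrib sum_subtractf)
  then have "complex_of_real (\<Sum>m\<in>reps k \<delta>. (norm (f m - g m))\<^sup>2) = 0"
    by (simp only: of_real_sum complex_norm_square mult.commute)
  then have "(\<Sum>m\<in>reps k \<delta>. (norm (f m - g m))\<^sup>2) = 0" by (simp only: of_real_eq_0_iff)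
  then have "f m = g m" if "m \<in> reps k \<delta>" for m
    using that by (subst (asm) sum_nonneg_eq_0_iff) (auto simp: finite_reps)
  \<comment> \<open>Agreement on representatives spreads to all lattice points by
    periodicity.\<close>
  then show "f = g"
    using I_space_periodic[OF k \<delta> f same_class_reduce] I_space_periodic[OF k \<delta> g same_class_reduce]
      reduce_in_reps[OF k \<delta>] by (metis ext)
qed

theorem theorem3p2:
  fixes \<Omega> :: "complex ^ 'n::{finite,wellorder} ^ 'n::{finite,wellorder}" and \<delta> :: "'n \<Rightarrow> nat" and k :: nat
  assumes sym: "transpose \<Omega> = \<Omega>"
    and posdef: "pos_def_real (Im_mat \<Omega>)"
    and dpos: "\<forall>i. \<delta> i > 0"
    and d1: "\<forall>i. (\<forall>j. i \<le> j) \<longrightarrow> \<delta> i = 1"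
    and ddvd: "\<forall>i j. i \<le> j \<longrightarrow> \<delta> i dvd \<delta> j"
    and kpos: "k > 0"
  shows
    "(C_ab \<Omega> (1 / real k) ` I_space k \<delta> = H_space k \<Omega> \<delta>
       \<and> (\<forall>m. C_ab \<Omega> (1 / real k) (theta0 k \<delta> m) = theta k \<Omega> \<delta> m))
     \<and> (\<forall>j z. nu \<Omega> (1 / real k) (z + axis j 1) = nu \<Omega> (1 / real k) z
         \<and> nu \<Omega> (1 / real k) (z + \<Omega> *v dmul \<delta> (axis j 1)) =
             complex_of_real (norm (exp (- 2 * pi * \<i> * of_nat k * z $ j * of_nat (\<delta> j)
                   - pi * \<i> * of_nat k * \<Omega> $ j $ j * of_nat (\<delta> j) ^ 2)) powr (-2))
             * nu \<Omega> (1 / real k) z)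
     \<and> inj_on (C_ab \<Omega> (1 / real k)) (I_space k \<delta>)
     \<and> (\<forall>f\<in>I_space k \<delta>. \<forall>g\<in>I_space k \<delta>.
          H_inner k \<Omega> \<delta> (C_ab \<Omega> (1 / real k) f) (C_ab \<Omega> (1 / real k) g) = I_inner k \<delta> f g)"
proof (intro conjI allI ballI)
  show "C_ab \<Omega> (1 / real k) ` I_space k \<delta> = H_space k \<Omega> \<delta>"
    by (rule C_ab_image_I_space[OF posdef kpos dpos])
  show "C_ab \<Omega> (1 / real k) (theta0 k \<delta> m) = theta k \<Omega> \<delta> m" for m
    by (rule C_ab_theta0[OF kpos dpos])
  show "nu \<Omega> (1 / real k) (z + axis j 1) = nu \<Omega> (1 / real k) z" for j z
    by (rule nu_add_axis)
  have "det (Im_mat \<Omega>) \<noteq> 0"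
    using pos_def_real_det_pos[OF transpose_Im_mat[OF sym] posdef] by simp
  then show "nu \<Omega> (1 / real k) (z + \<Omega> *v dmul \<delta> (axis j 1)) =
      complex_of_real (norm (exp (- 2 * pi * \<i> * of_nat k * z $ j * of_nat (\<delta> j)
          - pi * \<i> * of_nat k * \<Omega> $ j $ j * of_nat (\<delta> j) ^ 2)) powr (-2))
        * nu \<Omega> (1 / real k) z" for j z
    by (rule nu_add_period[OF sym])
  show "inj_on (C_ab \<Omega> (1 / real k)) (I_space k \<delta>)"
    by (rule inj_on_C_ab[OF sym posdef kpos dpos])
  show "H_inner k \<Omega> \<delta> (C_ab \<Omega> (1 / real k) f) (C_ab \<Omega> (1 / real k) g) = I_inner k \<delta> f g"
    if "f \<in> I_space k \<delta>" "g \<in> I_space k \<delta>" for f g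
    by (rule C_ab_isometry[OF sym posdef kpos dpos that])
qed

end
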